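(* Assume the collision kernel satisfies $\sigma(g,\theta)\approx g$. Suppose $f\ge0$ and $f\in L^1_1(\mathbb{R}^3)$. Then, for an arbitrary energy-momentum vector $a^\mu$, $$\int_{\mathbb{R}^3}\frac{(p^0)^{1/2}}{g(p^\mu,a^\mu)}\,Q^+(f,f)(p)\,dp\le C\sqrt{a^0}\,\|f\|_{L^1_1}^2,$$ where $C>0$ is a constant independent of $f$ and $a^\mu$.
   Context: Notation. For $p\in\mathbb{R}^3$ let $p^0=\sqrt{1+|p|^2}$ and $p^\mu=(p^0,p)$. The Lorentz product of 4-vectors is $a^\mu b_\mu=-a^0b^0+\sum_{i=1}^3a^ib^i$. An energy-momentum vector is a 4-vector $a^\mu=(a^0,a)$ with $a^\mu a_\mu=-1$ and $a^0>0$, i.e. $a^0=\sqrt{1+|a|^2}$. For energy-momentum vectors put $g(p^\mu,q^\mu)=\sqrt{(p^\mu-q^\mu)(p_\mu-q_\mu)}=\sqrt{|p-q|^2-(p^0-q^0)^2}$ and $s=s(p^\mu,q^\mu)=2(-p^\mu q_\mu+1)=g^2+4$. The symbols $g$, $s$ without arguments mean $g(p^\mu,q^\mu)$, $s(p^\mu,q^\mu)$. The Møller velocity is $v_\phi=\frac{g\sqrt s}{p^0q^0}$. For $\omega\in\mathbb{S}^2$ the post-collisional momenta are $$p'=\tfrac{p+q}{2}+\tfrac g2\Big(\omega+(\gamma-1)(p+q)\tfrac{(p+q)\cdot\omega}{|p+q|^2}\Big),\quad q'=\tfrac{p+q}{2}-\tfrac g2\Big(\omega+(\gamma-1)(p+q)\tfrac{(p+q)\cdot\omega}{|p+q|^2}\Big),$$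 with $\gamma=(p^0+q^0)/\sqrt s$; then $p^\mu+q^\mu=p'^\mu+q'^\mu$. The scattering angle is given by $\cos\theta=(p^\mu-q^\mu)(p'_\mu-q'_\mu)/g^2$. The collision kernel $\sigma(g,\theta)\ge0$ is measurable, and $\sigma\approx g$ means $c^{-1}g\le\sigma(g,\theta)\le cg$ for some constant $c>0$. The gain operator is $$Q^+(f,h)(p)=\int_{\mathbb{R}^3\times\mathbb{S}^2}v_\phi\,\sigma(g,\theta)f(p')h(q')\,d\omega\,dq .$$ Norm: $\|f\|_{L^1_1}=\int_{\mathbb{R}^3}p^0|f(p)|\,dp$. *)

theory Defs
  imports "HOL-Analysis.Analysis"
begin

type_synonym vec3 = "real ^ 3"
type_synonym vec4 = "real \<times> vec3"

definition energy :: "vec3 \<Rightarrow> real" where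
  "energy p = sqrt (1 + (norm p)\<^sup>2)"

definition four :: "vec3 \<Rightarrow> vec4" where
  "four p = (energy p, p)"

definition lorentz :: "vec4 \<Rightarrow> vec4 \<Rightarrow> real" where
  "lorentz a b = - (fst a * fst b) + snd a \<bullet> snd b"

definition energy_momentum :: "vec4 \<Rightarrow> bool" where
  "energy_momentum a \<longleftrightarrow> lorentz a a = - 1 \<and> fst a > 0"

definition rel_momentum :: "vec4 \<Rightarrow> vec4 \<Rightarrow> real" where
  "rel_momentum a b = sqrt (lorentz (a - b) (a - b))"

definition s_inv :: "vec4 \<Rightarrow> vec4 \<Rightarrow> real" where
  "s_inv a b = 2 * (- lorentz a b + 1)"

definition moller :: "vec3 \<Rightarrow> vec3 \<Rightarrow> real" where
  "moller p q =
     rel_momentum (four p) (four q) * sqrt (s_inv (four p) (four q)) / (energy p * energy q)"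

text \<open>When \<open>p + q = 0\<close> one has \<open>\<gamma> = 1\<close>, and the convention \<open>x / 0 = 0\<close> gives the
  continuous extension of the formulas for \<open>p'\<close> and \<open>q'\<close>.\<close>

definition collision_shift :: "vec3 \<Rightarrow> vec3 \<Rightarrow> vec3 \<Rightarrow> vec3" where
  "collision_shift p q \<omega> =
     (let \<gamma> = (energy p + energy q) / sqrt (s_inv (four p) (four q))
      in (rel_momentum (four p) (four q) / 2) *\<^sub>R
           (\<omega> + ((\<gamma> - 1) * (((p + q) \<bullet> \<omega>) / (norm (p + q))\<^sup>2)) *\<^sub>R (p + q)))"

definition post_p :: "vec3 \<Rightarrow> vec3 \<Rightarrow> vec3 \<Rightarrow> vec3" where
  "post_p p q \<omega> = (1 / 2) *\<^sub>R (p + q) + collision_shift p q \<omega>"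

definition post_q :: "vec3 \<Rightarrow> vec3 \<Rightarrow> vec3 \<Rightarrow> vec3" where
  "post_q p q \<omega> = (1 / 2) *\<^sub>R (p + q) - collision_shift p q \<omega>"

definition scattering_angle :: "vec3 \<Rightarrow> vec3 \<Rightarrow> vec3 \<Rightarrow> real" where
  "scattering_angle p q \<omega> =
     arccos (lorentz (four p - four q) (four (post_p p q \<omega>) - four (post_q p q \<omega>))
             / (rel_momentum (four p) (four q))\<^sup>2)"

definition collision_kernel :: "(real \<Rightarrow> real \<Rightarrow> real) \<Rightarrow> bool" where
  "collision_kernel \<sigma> \<longleftrightarrow>
     case_prod \<sigma> \<in> borel_measurable (lebesgue_on ({0<..} \<times> {0..pi})) \<and>
     (\<forall>g>0. \<forall>\<theta>\<in>{0..pi}. \<sigma> g \<theta> \<ge> 0)"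

definition kernel_approx_g :: "(real \<Rightarrow> real \<Rightarrow> real) \<Rightarrow> bool" where
  "kernel_approx_g \<sigma> \<longleftrightarrow>
     (\<exists>c>0. \<forall>g>0. \<forall>\<theta>\<in>{0..pi}. inverse c * g \<le> \<sigma> g \<theta> \<and> \<sigma> g \<theta> \<le> c * g)"

text \<open>Surface measure on the unit sphere of an \<open>n\<close>-dimensional space: the measure of \<open>A\<close> is \<open>n\<close>
  times the Lebesgue measure of the cone \<open>{r x | x \<in> A, 0 < r \<le> 1}\<close>. Here \<open>sgn x = x / |x|\<close>; the
  point mapped to \<open>sgn 0 = 0\<close> is a null set and is removed by the restriction.\<close>

definition sphere_measure :: "'a::euclidean_space measure" where
  "sphere_measure =
     restrict_space
       (distr (density lborel (\<lambda>x. of_nat DIM('a) * indicator (cball 0 1) x)) borel sgn)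
       (sphere 0 1)"

lemma space_sphere_measure: "space (sphere_measure :: 'a::euclidean_space measure) = sphere 0 1"
  by (simp add: sphere_measure_def space_restrict_space)

lemma emeasure_sphere_measure_sphere:
  "emeasure (sphere_measure :: vec3 measure) (sphere 0 1) = ennreal (4 * pi)"
proof -
  let ?D = "density lborel (\<lambda>x::vec3. of_nat DIM(vec3) * indicator (cball 0 1) x)"
  have [measurable]: "sgn \<in> borel_measurable (borel :: vec3 measure)"
    unfolding sgn_div_norm[abs_def] by measurable
  have S: "sphere (0::vec3) 1 \<in> sets borel" by simp
  have "emeasure (sphere_measure :: vec3 measure) (sphere 0 1)
        = emeasure (distr ?D borel sgn) (sphere 0 1)"
    unfolding sphere_measure_def by (rule emeasure_restrict_space) (use S in auto)
  also have "\<dots> = emeasure ?D (sgn -` sphere 0 1)"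
    by (subst emeasure_distr) (auto simp: S)
  also have "sgn -` sphere 0 1 = - {0::vec3}"
    by (auto simp: norm_sgn)
  also have "emeasure ?D (- {0}) = (\<integral>\<^sup>+x. 3 * indicator (cball 0 1 - {0::vec3}) x \<partial>lborel)"
    by (subst emeasure_density)
       (auto intro!: nn_integral_cong simp: indicator_def)
  also have "\<dots> = 3 * emeasure lborel (cball 0 1 - {0::vec3})"
    by (subst nn_integral_cmult_indicator) auto
  also have "emeasure lborel (cball 0 1 - {0::vec3}) = emeasure lborel (cball (0::vec3) 1)"
    by (rule emeasure_Diff_null_set) (auto simp: null_sets_def)
  also have "\<dots> = ennreal (4 / 3 * pi)"
    by (subst emeasure_cball) (auto simp: unit_ball_vol_numeral fact_numeral)
  also have "3 * ennreal (4 / 3 * pi) = ennreal (4 * pi)"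
    by (simp add: ennreal_mult'[symmetric] flip: ennreal_numeral)
  finally show ?thesis .
qed

text \<open>The integral is taken in \<open>[0, \<infinity>]\<close>, so this is the gain operator for nonnegative \<open>f\<close> and \<open>h\<close>
  only.\<close>

definition gain :: "(real \<Rightarrow> real \<Rightarrow> real) \<Rightarrow> (vec3 \<Rightarrow> real) \<Rightarrow> (vec3 \<Rightarrow> real) \<Rightarrow> vec3 \<Rightarrow> ennreal" where
  "gain \<sigma> f h p =
     (\<integral>\<^sup>+(q, \<omega>). ennreal (moller p q
          * \<sigma> (rel_momentum (four p) (four q)) (scattering_angle p q \<omega>)
          * f (post_p p q \<omega>) * h (post_q p q \<omega>)) \<partial>(lborel \<Otimes>\<^sub>M sphere_measure))"

definition L11 :: "(vec3 \<Rightarrow> real) \<Rightarrow> bool" where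
  "L11 f \<longleftrightarrow> f \<in> borel_measurable lebesgue \<and> integrable lebesgue (\<lambda>p. energy p * \<bar>f p\<bar>)"

definition L11_norm :: "(vec3 \<Rightarrow> real) \<Rightarrow> real" where
  "L11_norm f = (\<integral>p. energy p * \<bar>f p\<bar> \<partial>lebesgue)"

end

theory Submission
  imports Defs
begin

section \<open>A weighted estimate for the relativistic gain operator\<close>

text \<open>
  For fixed total momentum \<open>P = p + q\<close> use the centre-of-mass momentum \<open>k\<close> as variable, so that
  \<open>g = 2 |k|\<close> and \<open>s = 4 (k\<^sup>0)\<^sup>2\<close>. The Jacobian of \<open>k \<mapsto> p\<close> is \<open>2 p\<^sup>0 q\<^sup>0 / (k\<^sup>0 (p\<^sup>0 + q\<^sup>0))\<close> and a
  collision replaces \<open>k\<close> by \<open>|k| \<omega>\<close>. By polar coordinates pre- and post-collisional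
  \<open>k\<close> can be exchanged, which moves the weight \<open>(p\<^sup>0)\<^sup>1\<^sup>/\<^sup>2 / g(p, a)\<close> into the integral over the
  sphere. There \<open>g(p, a) \<ge> |p - a| / sqrt (p\<^sup>0 a\<^sup>0)\<close>, and since the map \<open>k \<mapsto> p\<close> is expanding on the
  sphere \<open>|k| = const\<close> the average is at most
  \<open>(p\<^sup>0 + q\<^sup>0) sqrt (a\<^sup>0) / |k|\<close> times \<open>\<integral> 1 / |\<omega> - c| d\<omega> \<le> 36 \<pi>\<close>. The remaining factor \<open>|k|\<close> is
  bounded by the Jacobian times \<open>p\<^sup>0 q\<^sup>0\<close>, and changing variables back gives the square of the norm.
\<close>

subsection \<open>Polar coordinates\<close>

lemma borel_measurable_sgn_euclidean [measurable]:
  "(sgn :: 'a::euclidean_space \<Rightarrow> 'a) \<in> borel_measurable borel"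
  unfolding sgn_div_norm[abs_def] by measurable

lemma measurable_ident_sphere_measure:
  "(\<lambda>x. x) \<in> measurable (sphere_measure :: 'a::euclidean_space measure) borel"
  unfolding sphere_measure_def by (intro measurable_restrict_space1) simp

lemma measurable_sphere_measure_borel:
  "f \<in> measurable borel M \<Longrightarrow> f \<in> measurable (sphere_measure :: 'a::euclidean_space measure) M"
  by (rule measurable_compose[OF measurable_ident_sphere_measure])

text \<open>Unfolds the cone description of surface measure into an integral over the unit ball,
  where Tonelli and scalings of Lebesgue measure apply.\<close>

lemma nn_integral_sphere_measure:
  fixes h :: "'a::euclidean_space \<Rightarrow> ennreal"
  assumes h [measurable]: "h \<in> borel_measurable borel"
  shows "(\<integral>\<^sup>+\<omega>. h \<omega> \<partial>sphere_measure) =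
    (\<integral>\<^sup>+x. of_nat DIM('a) * indicator (cball 0 1) x * h (sgn x) \<partial>lborel)"
proof -
  let ?D = "density lborel (\<lambda>x::'a. of_nat DIM('a) * indicator (cball 0 1) x :: ennreal)"
  have sgn: "sgn \<in> measurable ?D borel" by simp
  have [measurable]: "sphere (0::'a) 1 \<in> sets borel" "cball (0::'a) 1 \<in> sets borel" by simp_all
  have hm: "(\<lambda>x. h x * indicator (sphere 0 1) x) \<in> borel_measurable borel" by measurable
  have "(\<integral>\<^sup>+\<omega>. h \<omega> \<partial>sphere_measure) =
      (\<integral>\<^sup>+x. h x * indicator (sphere 0 1) x \<partial>distr ?D borel sgn)"
    unfolding sphere_measure_def by (rule nn_integral_restrict_space) simp
  also have "\<dots> = (\<integral>\<^sup>+x. h (sgn x) * indicator (sphere 0 1) (sgn x) \<partial>?D)"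
    by (rule nn_integral_distr[OF sgn]) (use hm in simp)
  also have "\<dots> =
     (\<integral>\<^sup>+x. of_nat DIM('a) * indicator (cball 0 1) x * (h (sgn x) * indicator (sphere 0 1) (sgn x)) \<partial>lborel)"
    by (rule nn_integral_density) simp_all
  \<comment> \<open>Off the null set {0} the map \<open>sgn\<close> lands on the unit sphere, so the
    second indicator equals 1.\<close>
  also have "\<dots> = (\<integral>\<^sup>+x. of_nat DIM('a) * indicator (cball 0 1) x * h (sgn x) \<partial>lborel)"
    by (rule nn_integral_cong_AE, rule AE_mp[OF AE_lborel_singleton[of 0]])
       (auto simp: indicator_def norm_sgn intro!: AE_I2)
  finally show ?thesis .
qed

lemma nn_integral_lborel_scaleR:
  fixes f :: "'a::euclidean_space \<Rightarrow> ennreal"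
  assumes [measurable]: "f \<in> borel_measurable borel" and t: "t > 0"
  shows "(\<integral>\<^sup>+x. f x \<partial>lborel) = ennreal (t ^ DIM('a)) * (\<integral>\<^sup>+x. f (t *\<^sub>R x) \<partial>lborel)"
proof -
  have "(\<integral>\<^sup>+x. f x \<partial>lborel) =
      (\<integral>\<^sup>+x. f x \<partial>density (distr lborel borel (\<lambda>x. 0 + t *\<^sub>R x)) (\<lambda>_. \<bar>t\<bar> ^ DIM('a)))"
    by (subst lborel_affine[of t "0::'a"]) (use t in auto)
  also have "\<dots> = (\<integral>\<^sup>+x. ennreal (t ^ DIM('a)) * f (t *\<^sub>R x) \<partial>lborel)"
    using t by (simp add: nn_integral_density nn_integral_distr)
  finally show ?thesis by (simp add: nn_integral_cmult)
qed

text \<open>An antiderivative is -(a/t)^n, which rises from -1 at t = a to 0 at infinity. With a =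
  |y| this is the total weight that the polar formula assigns to a point y.\<close>

lemma nn_integral_tail_power:
  fixes a :: real
  assumes "a > 0" and n: "n > 0"
  shows "(\<integral>\<^sup>+t. ennreal (of_nat n * a ^ n / t ^ Suc n) * indicator {a..} t \<partial>lborel) = 1"
proof -
  have "(\<integral>\<^sup>+t. ennreal (of_nat n * a ^ n / t ^ Suc n) * indicator {a..} t \<partial>lborel) =
     ennreal (0 - (- (a ^ n / a ^ n)))"
  proof (rule nn_integral_FTC_atLeast[where F = "\<lambda>t. - (a ^ n / t ^ n)"])
    fix t assume "a \<le> t"
    then have t: "t > 0" using assms by simp
    have "t * (t ^ n) * (t ^ (n - 1)) = t ^ n * t ^ n" using n by (cases n) auto
    then show "((\<lambda>t. - (a ^ n / t ^ n)) has_real_derivative real n * a ^ n / t ^ Suc n) (at t)"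
      using t by (auto intro!: derivative_eq_intros simp: field_simps)
    show "0 \<le> real n * a ^ n / t ^ Suc n" using t assms by simp
  next
    have "((\<lambda>t. - (a ^ n * inverse (t ^ n))) \<longlongrightarrow> - (a ^ n * 0)) at_top"
      using n by (intro tendsto_intros tendsto_inverse_0_at_top filterlim_pow_at_top filterlim_ident) auto
    then show "((\<lambda>t. - (a ^ n / t ^ n)) \<longlongrightarrow> 0) at_top" by (simp add: divide_inverse)
  qed auto
  then show ?thesis using assms by simp
qed

text \<open>Writing the sphere integral as an integral over the unit ball, the formula reduces to Tonelli
  and two homothetic substitutions.\<close>

lemma nn_integral_polar:
  fixes h :: "'a::euclidean_space \<Rightarrow> ennreal"
  assumes h [measurable]: "h \<in> borel_measurable borel"
  shows "(\<integral>\<^sup>+x. h x \<partial>lborel) = (\<integral>\<^sup>+r. ennreal (r ^ (DIM('a) - 1)) * indicator {0<..} r *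
     (\<integral>\<^sup>+\<omega>. h (r *\<^sub>R \<omega>) \<partial>sphere_measure) \<partial>lborel)"
proof -
  let ?n = "DIM('a)"
  have n: "?n > 0" by simp
  have [measurable]: "cball (0::'a) 1 \<in> sets borel" by simp
  let ?b = "\<lambda>x::'a. of_nat ?n * indicator (cball 0 1) x :: ennreal"
  have "(\<integral>\<^sup>+r. ennreal (r ^ (?n - 1)) * indicator {0<..} r *
      (\<integral>\<^sup>+\<omega>. h (r *\<^sub>R \<omega>) \<partial>sphere_measure) \<partial>lborel) =
    (\<integral>\<^sup>+r. (\<integral>\<^sup>+x. ennreal (r ^ (?n - 1)) * indicator {0<..} r * (?b x * h (r *\<^sub>R sgn x)) \<partial>lborel) \<partial>lborel)"
  proof (rule nn_integral_cong)
    fix r :: real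
    have [measurable]: "(\<lambda>x. h (r *\<^sub>R x)) \<in> borel_measurable borel"
      "(\<lambda>x. ?b x * h (r *\<^sub>R sgn x)) \<in> borel_measurable borel" by measurable
    show "ennreal (r ^ (?n - 1)) * indicator {0<..} r * (\<integral>\<^sup>+\<omega>. h (r *\<^sub>R \<omega>) \<partial>sphere_measure) =
      (\<integral>\<^sup>+x. ennreal (r ^ (?n - 1)) * indicator {0<..} r * (?b x * h (r *\<^sub>R sgn x)) \<partial>lborel)"
      by (subst nn_integral_cmult, simp) (subst nn_integral_sphere_measure, simp_all)
  qed
  also have "\<dots> =
    (\<integral>\<^sup>+x. (\<integral>\<^sup>+r. ennreal (r ^ (?n - 1)) * indicator {0<..} r * (?b x * h (r *\<^sub>R sgn x)) \<partial>lborel) \<partial>lborel)"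
    by (rule lborel_pair.Fubini'[symmetric]) measurable
  \<comment> \<open>Substituting r = |x| t turns r \<open>sgn\<close> x into t x; the powers of |x|
    collect to |x|^n.\<close>
  also have "\<dots> = (\<integral>\<^sup>+x. (\<integral>\<^sup>+t. ennreal (t ^ (?n - 1)) * indicator {0<..} t *
      (?b x * ennreal (norm x ^ ?n) * h (t *\<^sub>R x)) \<partial>lborel) \<partial>lborel)"
  proof (rule nn_integral_cong_AE, rule AE_mp[OF AE_lborel_singleton[of 0]], rule AE_I2, rule impI)
    fix x :: 'a assume x: "x \<noteq> 0"
    have "(\<integral>\<^sup>+r. ennreal (r ^ (?n - 1)) * indicator {0<..} r * (?b x * h (r *\<^sub>R sgn x)) \<partial>lborel) =
      ennreal \<bar>norm x\<bar> * (\<integral>\<^sup>+t. ennreal ((0 + norm x * t) ^ (?n - 1)) * indicator {0<..} (0 + norm x * t) *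
        (?b x * h ((0 + norm x * t) *\<^sub>R sgn x)) \<partial>lborel)"
      by (rule nn_integral_real_affine) (use x in \<open>auto\<close>)
    also have "\<dots> = (\<integral>\<^sup>+t. ennreal (norm x) * (ennreal ((norm x * t) ^ (?n - 1)) * indicator {0<..} (norm x * t) *
        (?b x * h ((norm x * t) *\<^sub>R sgn x))) \<partial>lborel)"
      by (simp add: nn_integral_cmult)
    also have "\<dots> = (\<integral>\<^sup>+t. ennreal (t ^ (?n - 1)) * indicator {0<..} t *
        (?b x * ennreal (norm x ^ ?n) * h (t *\<^sub>R x)) \<partial>lborel)"
    proof (rule nn_integral_cong)
      fix t :: real
      show "ennreal (norm x) * (ennreal ((norm x * t) ^ (?n - 1)) * indicator {0<..} (norm x * t) *
          (?b x * h ((norm x * t) *\<^sub>R sgn x))) = ennreal (t ^ (?n - 1)) * indicator {0<..} t *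
          (?b x * ennreal (norm x ^ ?n) * h (t *\<^sub>R x))"
      proof (cases "t > 0")
        case True
        have "(norm x * t) *\<^sub>R sgn x = t *\<^sub>R x" using x by (simp add: sgn_div_norm)
        moreover have "ennreal (norm x) * ennreal ((norm x * t) ^ (?n - 1)) =
            ennreal (t ^ (?n - 1)) * ennreal (norm x ^ ?n)"
          using True n by (simp add: ennreal_mult[symmetric] power_mult_distrib power_eq_if[of _ ?n] mult_ac)
        ultimately show ?thesis using x True
          by (simp add: zero_less_mult_iff mult_ac indicator_def) (metis mult.assoc mult.commute)
      qed (use x in \<open>simp add: zero_less_mult_iff\<close>)
    qed
    finally show "(\<integral>\<^sup>+r. ennreal (r ^ (?n - 1)) * indicator {0<..} r * (?b x * h (r *\<^sub>R sgn x)) \<partial>lborel) =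
      (\<integral>\<^sup>+t. ennreal (t ^ (?n - 1)) * indicator {0<..} t * (?b x * ennreal (norm x ^ ?n) * h (t *\<^sub>R x)) \<partial>lborel)" .
  qed
  also have "\<dots> = (\<integral>\<^sup>+t. (\<integral>\<^sup>+x. ennreal (t ^ (?n - 1)) * indicator {0<..} t *
      (?b x * ennreal (norm x ^ ?n) * h (t *\<^sub>R x)) \<partial>lborel) \<partial>lborel)"
    by (rule lborel_pair.Fubini') measurable
  \<comment> \<open>Substituting y = t x for fixed t > 0 maps the unit ball onto |y| \<le> t, which
    after Tonelli becomes the range t \<ge> |y|.\<close>
  also have "\<dots> = (\<integral>\<^sup>+t. (\<integral>\<^sup>+y. h y * (ennreal (of_nat ?n * norm y ^ ?n / t ^ Suc ?n) *
      (indicator {norm y..} t * indicator {0<..} t)) \<partial>lborel) \<partial>lborel)"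
  proof (rule nn_integral_cong)
    fix t :: real
    show "(\<integral>\<^sup>+x. ennreal (t ^ (?n - 1)) * indicator {0<..} t *
        (?b x * ennreal (norm x ^ ?n) * h (t *\<^sub>R x)) \<partial>lborel) =
      (\<integral>\<^sup>+y. h y * (ennreal (of_nat ?n * norm y ^ ?n / t ^ Suc ?n) *
        (indicator {norm y..} t * indicator {0<..} t)) \<partial>lborel)"
    proof (cases "t > 0")
      case t: True
      have "(\<lambda>x::'a. indicator {norm x..} t :: ennreal) = indicator (cball 0 t)"
        by (auto simp: indicator_def)
      also have "\<dots> \<in> borel_measurable borel" by (rule borel_measurable_indicator) simp
      finally have ind: "(\<lambda>x::'a. indicator {norm x..} t :: ennreal) \<in> borel_measurable borel" .
      have "(\<integral>\<^sup>+y. h y * (ennreal (of_nat ?n * norm y ^ ?n / t ^ Suc ?n) *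
          (indicator {norm y..} t * indicator {0<..} t)) \<partial>lborel) =
        ennreal (t ^ ?n) * (\<integral>\<^sup>+x. h (t *\<^sub>R x) * (ennreal (of_nat ?n * norm (t *\<^sub>R x) ^ ?n / t ^ Suc ?n) *
          (indicator {norm (t *\<^sub>R x)..} t * indicator {0<..} t)) \<partial>lborel)"
        by (rule nn_integral_lborel_scaleR[OF _ t])
          (intro borel_measurable_times_ennreal borel_measurable_const ind h; measurable)
      also have "\<dots> = (\<integral>\<^sup>+x. ennreal (t ^ ?n) * (h (t *\<^sub>R x) * (ennreal (of_nat ?n * norm (t *\<^sub>R x) ^ ?n / t ^ Suc ?n) *
          (indicator {norm (t *\<^sub>R x)..} t * indicator {0<..} t))) \<partial>lborel)"
        by (rule nn_integral_cmult[symmetric]) (intro borel_measurable_times_ennreal borel_measurable_const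
          measurable_compose[OF _ ind] measurable_compose[OF _ h]; measurable)
      also have "\<dots> = (\<integral>\<^sup>+x. ennreal (t ^ (?n - 1)) * indicator {0<..} t *
        (?b x * ennreal (norm x ^ ?n) * h (t *\<^sub>R x)) \<partial>lborel)"
      proof (rule nn_integral_cong)
        fix x :: 'a
        have i: "indicator {norm (t *\<^sub>R x)..} t = (indicator (cball 0 1) x :: ennreal)"
          using t mult_le_cancel_left_pos[of t "norm x" 1] by (simp add: indicator_def)
        have "t ^ ?n = t * t ^ (?n - 1)" using n by (simp add: power_eq_if[of _ ?n])
        then have e: "ennreal (t ^ ?n) * ennreal (of_nat ?n * norm (t *\<^sub>R x) ^ ?n / t ^ Suc ?n) =
            ennreal (t ^ (?n - 1)) * (of_nat ?n * ennreal (norm x ^ ?n))"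
          using t by (simp add: ennreal_mult[symmetric] power_mult_distrib ennreal_of_nat_eq_real_of_nat field_simps)
        show "ennreal (t ^ ?n) * (h (t *\<^sub>R x) * (ennreal (of_nat ?n * norm (t *\<^sub>R x) ^ ?n / t ^ Suc ?n) *
          (indicator {norm (t *\<^sub>R x)..} t * indicator {0<..} t))) = ennreal (t ^ (?n - 1)) * indicator {0<..} t *
          (?b x * ennreal (norm x ^ ?n) * h (t *\<^sub>R x))" (is "?l * (?h * (?e * (?i * ?j))) = ?r")
        proof -
          have "?l * (?h * (?e * (?i * ?j))) = (?l * ?e) * ?h * ?i * ?j" by (simp add: mult_ac)
          also have "\<dots> = ?r" unfolding e i by (simp add: mult_ac)
          finally show ?thesis .
        qed
      qed
      finally show ?thesis ..
    qed simp
  qed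
  also have "\<dots> = (\<integral>\<^sup>+y. (\<integral>\<^sup>+t. h y * (ennreal (of_nat ?n * norm y ^ ?n / t ^ Suc ?n) *
      (indicator {norm y..} t * indicator {0<..} t)) \<partial>lborel) \<partial>lborel)"
  proof (rule lborel_pair.Fubini'[symmetric])
    have "(\<lambda>z::real \<times> 'a. indicator {norm (snd z)..} (fst z) :: ennreal) = (\<lambda>z. if norm (snd z) \<le> fst z then 1 else 0)"
      by (auto simp: indicator_def)
    also have "\<dots> \<in> borel_measurable (lborel \<Otimes>\<^sub>M lborel)" by measurable
    finally have [measurable]:
      "(\<lambda>z::real \<times> 'a. indicator {norm (snd z)..} (fst z) :: ennreal) \<in> borel_measurable (lborel \<Otimes>\<^sub>M lborel)" .
    show "(\<lambda>(t, y). h y * (ennreal (of_nat ?n * norm y ^ ?n / t ^ Suc ?n) *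
      (indicator {norm y..} t * indicator {0<..} t))) \<in> borel_measurable (lborel \<Otimes>\<^sub>M lborel)"
      unfolding split_beta by measurable
  qed
  also have "\<dots> = (\<integral>\<^sup>+y. h y \<partial>lborel)"
  proof (rule nn_integral_cong_AE, rule AE_mp[OF AE_lborel_singleton[of 0]], rule AE_I2, rule impI)
    fix y :: 'a assume y: "y \<noteq> 0"
    have "(\<integral>\<^sup>+t. h y * (ennreal (of_nat ?n * norm y ^ ?n / t ^ Suc ?n) *
        (indicator {norm y..} t * indicator {0<..} t)) \<partial>lborel) =
      (\<integral>\<^sup>+t. h y * (ennreal (of_nat ?n * norm y ^ ?n / t ^ Suc ?n) * indicator {norm y..} t) \<partial>lborel)"
    proof (rule nn_integral_cong)
      fix t :: real
      have "norm y \<le> t \<Longrightarrow> t > 0" using y zero_less_norm_iff[of y] by linarith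
      then show "h y * (ennreal (of_nat ?n * norm y ^ ?n / t ^ Suc ?n) * (indicator {norm y..} t * indicator {0<..} t)) =
          h y * (ennreal (of_nat ?n * norm y ^ ?n / t ^ Suc ?n) * indicator {norm y..} t)"
        by (auto simp: indicator_def)
    qed
    also have "\<dots> = h y * 1"
      by (subst nn_integral_cmult, measurable, subst nn_integral_tail_power) (use y n in auto)
    finally show "(\<integral>\<^sup>+t. h y * (ennreal (of_nat ?n * norm y ^ ?n / t ^ Suc ?n) *
        (indicator {norm y..} t * indicator {0<..} t)) \<partial>lborel) = h y" by simp
  qed
  finally show ?thesis ..
qed

section \<open>Exchange of two points on a common sphere\<close>

lemma sigma_finite_sphere_measure: "sigma_finite_measure (sphere_measure :: vec3 measure)"
proof -
  have "finite_measure (sphere_measure :: vec3 measure)"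
    by (rule finite_measureI) (simp add: space_sphere_measure emeasure_sphere_measure_sphere)
  then show ?thesis by (rule finite_measure.axioms)
qed

lemma measurable_pair_sphere_measure:
  fixes f :: "'b \<times> 'a::euclidean_space \<Rightarrow> 'c"
  assumes "f \<in> measurable (N \<Otimes>\<^sub>M borel) M"
  shows "f \<in> measurable (N \<Otimes>\<^sub>M (sphere_measure :: 'a measure)) M"
proof -
  have "(\<lambda>z. (fst z, snd z)) \<in> measurable (N \<Otimes>\<^sub>M (sphere_measure :: 'a measure)) (N \<Otimes>\<^sub>M borel)"
    by (intro measurable_Pair measurable_fst measurable_compose[OF measurable_snd measurable_ident_sphere_measure])
  from measurable_compose[OF this assms] show ?thesis by simp
qed

lemma borel_measurable_nn_integral_sphere:
  fixes f :: "'b \<Rightarrow> vec3 \<Rightarrow> ennreal"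
  assumes "case_prod f \<in> borel_measurable (N \<Otimes>\<^sub>M borel)"
  shows "(\<lambda>x. \<integral>\<^sup>+\<omega>. f x \<omega> \<partial>sphere_measure) \<in> borel_measurable N"
  by (intro sigma_finite_measure.borel_measurable_nn_integral sigma_finite_sphere_measure
      measurable_pair_sphere_measure assms)

lemma pair_sigma_finite_sphere_measure:
  "pair_sigma_finite (sphere_measure :: vec3 measure) (sphere_measure :: vec3 measure)"
  by (intro pair_sigma_finite.intro sigma_finite_sphere_measure)

text \<open>In polar coordinates both sides become an integral over the radius r, with weight r^2,
  of a double integral over two unit vectors. Tonelli lets these two exchange roles.\<close>

lemma nn_integral_sphere_swap:
  fixes B :: "vec3 \<Rightarrow> vec3 \<Rightarrow> ennreal"
  assumes B [measurable]: "case_prod B \<in> borel_measurable (borel \<Otimes>\<^sub>M borel)"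
  shows "(\<integral>\<^sup>+k. \<integral>\<^sup>+\<omega>. B k (norm k *\<^sub>R \<omega>) \<partial>sphere_measure \<partial>lborel) =
    (\<integral>\<^sup>+k. \<integral>\<^sup>+\<omega>. B (norm k *\<^sub>R \<omega>) k \<partial>sphere_measure \<partial>lborel)"
proof -
  have polar: "(\<integral>\<^sup>+k. \<integral>\<^sup>+\<omega>. D k (norm k *\<^sub>R \<omega>) \<partial>sphere_measure \<partial>lborel) =
    (\<integral>\<^sup>+r. ennreal (r ^ 2) * indicator {0<..} r * (\<integral>\<^sup>+\<eta>. \<integral>\<^sup>+\<omega>. D (r *\<^sub>R \<eta>) (r *\<^sub>R \<omega>)
       \<partial>sphere_measure \<partial>sphere_measure) \<partial>lborel)"
    if [measurable]: "case_prod D \<in> borel_measurable (borel \<Otimes>\<^sub>M borel)" for D :: "vec3 \<Rightarrow> vec3 \<Rightarrow> ennreal"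
  proof -
    have "(\<lambda>k. \<integral>\<^sup>+\<omega>. D k (norm k *\<^sub>R \<omega>) \<partial>sphere_measure) \<in> borel_measurable borel"
      by (rule borel_measurable_nn_integral_sphere) measurable
    then have "(\<integral>\<^sup>+k. \<integral>\<^sup>+\<omega>. D k (norm k *\<^sub>R \<omega>) \<partial>sphere_measure \<partial>lborel) =
      (\<integral>\<^sup>+r. ennreal (r ^ 2) * indicator {0<..} r * (\<integral>\<^sup>+\<eta>. \<integral>\<^sup>+\<omega>. D (r *\<^sub>R \<eta>) (norm (r *\<^sub>R \<eta>) *\<^sub>R \<omega>)
         \<partial>sphere_measure \<partial>sphere_measure) \<partial>lborel)"
      by (subst nn_integral_polar) simp_all
    \<comment> \<open>The indicator restricts to r > 0, where a unit vector scaled by r has norm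
      r.\<close>
    also have "\<dots> = (\<integral>\<^sup>+r. ennreal (r ^ 2) * indicator {0<..} r * (\<integral>\<^sup>+\<eta>. \<integral>\<^sup>+\<omega>. D (r *\<^sub>R \<eta>) (r *\<^sub>R \<omega>)
         \<partial>sphere_measure \<partial>sphere_measure) \<partial>lborel)"
    proof (intro nn_integral_cong)
      fix r :: real
      show "ennreal (r ^ 2) * indicator {0<..} r * (\<integral>\<^sup>+\<eta>. \<integral>\<^sup>+\<omega>. D (r *\<^sub>R \<eta>) (norm (r *\<^sub>R \<eta>) *\<^sub>R \<omega>)
         \<partial>sphere_measure \<partial>sphere_measure) = ennreal (r ^ 2) * indicator {0<..} r *
         (\<integral>\<^sup>+\<eta>. \<integral>\<^sup>+\<omega>. D (r *\<^sub>R \<eta>) (r *\<^sub>R \<omega>) \<partial>sphere_measure \<partial>sphere_measure)"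
      proof (cases "r > 0")
        case True
        then have "(\<integral>\<^sup>+\<eta>. \<integral>\<^sup>+\<omega>. D (r *\<^sub>R \<eta>) (norm (r *\<^sub>R \<eta>) *\<^sub>R \<omega>) \<partial>sphere_measure \<partial>sphere_measure) =
          (\<integral>\<^sup>+\<eta>. \<integral>\<^sup>+\<omega>. D (r *\<^sub>R \<eta>) (r *\<^sub>R \<omega>) \<partial>sphere_measure \<partial>sphere_measure)"
          by (intro nn_integral_cong) (simp add: space_sphere_measure)
        then show ?thesis by simp
      qed simp
    qed
    finally show ?thesis .
  qed
  have [measurable]: "(\<lambda>(x, y). B y x) \<in> borel_measurable (borel \<Otimes>\<^sub>M borel)"
    using measurable_pair_swap[OF B] by simp
  have "(\<integral>\<^sup>+\<eta>. \<integral>\<^sup>+\<omega>. B (r *\<^sub>R \<eta>) (r *\<^sub>R \<omega>) \<partial>sphere_measure \<partial>sphere_measure) =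
        (\<integral>\<^sup>+\<eta>. \<integral>\<^sup>+\<omega>. B (r *\<^sub>R \<omega>) (r *\<^sub>R \<eta>) \<partial>sphere_measure \<partial>sphere_measure)" for r
  proof (rule pair_sigma_finite.Fubini'[OF pair_sigma_finite_sphere_measure])
    have "(\<lambda>(x, y). B (r *\<^sub>R y) (r *\<^sub>R x)) \<in> borel_measurable (borel \<Otimes>\<^sub>M borel)" by measurable
    \<comment> \<open>Measurability passes to the sphere one factor at a time, with a swap of the
      factors in between.\<close>
    then show "(\<lambda>(x, y). B (r *\<^sub>R y) (r *\<^sub>R x)) \<in> borel_measurable (sphere_measure \<Otimes>\<^sub>M sphere_measure)"
      by (intro measurable_pair_sphere_measure)
         (subst measurable_pair_swap_iff, rule measurable_pair_sphere_measure, measurable)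
  qed
  then show ?thesis
    using polar[OF B] polar[of "\<lambda>k l. B l k"] \<open>(\<lambda>(x, y). B y x) \<in> _\<close> by simp
qed

section \<open>Averages of the reciprocal distance over the unit sphere\<close>

text \<open>A two-dimensional singularity on the sphere is traded for a three-dimensional one: if
  \<open>d = |\<omega> - c| < 1\<close>, then \<open>|r \<omega> - c| \<le> 2 d\<close> for \<open>1 \<le> r \<le> 1 + d\<close>.\<close>

lemma inverse_dist_le_radial_integral:
  fixes c \<omega> :: vec3
  assumes "norm \<omega> = 1"
  shows "ennreal (1 / norm (\<omega> - c)) \<le> 1 + 4 * (\<integral>\<^sup>+r. ennreal (r\<^sup>2) * indicator {0<..} r *
    ennreal (indicator (cball 0 2) (r *\<^sub>R \<omega> - c) / (norm (r *\<^sub>R \<omega> - c))\<^sup>2) \<partial>lborel)"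
proof (cases "norm (\<omega> - c) \<in> {0<..<1}")
  \<comment> \<open>Either the distance is at least 1, or it is 0 and the quotient takes the default
    value 0.\<close>
  case False
  then have "1 / norm (\<omega> - c) \<le> 1" by (auto simp: divide_simps not_less)
  then have "ennreal (1 / norm (\<omega> - c)) \<le> 1" using ennreal_leI by fastforce
  then show ?thesis by (rule order_trans) simp
next
  case True
  define d where "d = norm (\<omega> - c)"
  have d: "0 < d" "d < 1" using True by (auto simp: d_def)
  \<comment> \<open>The interval [1, 1 + d] has length d, so the constant 1 / (4 d^2) integrates
    over it to 1 / (4 d).\<close>
  have "ennreal (1 / d) = 4 * (ennreal (1 / (4 * d\<^sup>2)) * emeasure lborel {1..1 + d})"
    using d by (simp add: ennreal_mult[symmetric] power2_eq_square flip: ennreal_numeral)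
  also have "ennreal (1 / (4 * d\<^sup>2)) * emeasure lborel {1..1 + d} =
      (\<integral>\<^sup>+r. ennreal (1 / (4 * d\<^sup>2)) * indicator {1..1 + d} r \<partial>lborel)"
    by (subst nn_integral_cmult_indicator) simp_all
  \<comment> \<open>At r \<omega> = c the right-hand integrand is 0 by the division convention and
    the pointwise bound may fail; this happens for at most one r.\<close>
  also have "AE r in lborel. r *\<^sub>R \<omega> \<noteq> c"
  proof -
    have "r = c \<bullet> \<omega>" if "r *\<^sub>R \<omega> = c" for r
      using assms that by (auto simp: norm_eq_1)
    then show ?thesis using AE_lborel_singleton[of "c \<bullet> \<omega>"] by (auto elim: eventually_mono)
  qed
  then have "(\<integral>\<^sup>+r. ennreal (1 / (4 * d\<^sup>2)) * indicator {1..1 + d} r \<partial>lborel) \<le>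
    (\<integral>\<^sup>+r. ennreal (r\<^sup>2) * indicator {0<..} r *
    ennreal (indicator (cball 0 2) (r *\<^sub>R \<omega> - c) / (norm (r *\<^sub>R \<omega> - c))\<^sup>2) \<partial>lborel)"
  proof (intro nn_integral_mono_AE, elim eventually_mono)
    fix r :: real assume ne: "r *\<^sub>R \<omega> \<noteq> c"
    show "ennreal (1 / (4 * d\<^sup>2)) * indicator {1..1 + d} r \<le> ennreal (r\<^sup>2) * indicator {0<..} r *
      ennreal (indicator (cball 0 2) (r *\<^sub>R \<omega> - c) / (norm (r *\<^sub>R \<omega> - c))\<^sup>2)"
    proof (cases "r \<in> {1..1 + d}")
      case True
      have "norm (r *\<^sub>R \<omega> - c) \<le> norm ((r - 1) *\<^sub>R \<omega>) + norm (\<omega> - c)"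
        by (rule order_trans[OF _ norm_triangle_ineq]) (simp add: algebra_simps)
      also have "\<dots> \<le> 2 * d" using True assms by (simp add: d_def[symmetric])
      finally have n: "norm (r *\<^sub>R \<omega> - c) \<le> 2 * d" .
      have pos: "norm (r *\<^sub>R \<omega> - c) > 0" using ne by simp
      have "1 / (4 * d\<^sup>2) = 1 / (2 * d)\<^sup>2" by (simp add: power_mult_distrib)
      also have "\<dots> \<le> 1 / (norm (r *\<^sub>R \<omega> - c))\<^sup>2"
        using n pos d by (intro divide_left_mono power_mono mult_pos_pos) auto
      also have "\<dots> \<le> r\<^sup>2 * (1 / (norm (r *\<^sub>R \<omega> - c))\<^sup>2)"
        using True mult_right_mono[of 1 "r\<^sup>2" "1 / (norm (r *\<^sub>R \<omega> - c))\<^sup>2"] by (simp add: one_le_power)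
      finally have "ennreal (1 / (4 * d\<^sup>2)) \<le> ennreal (r\<^sup>2 * (1 / (norm (r *\<^sub>R \<omega> - c))\<^sup>2))" by (rule ennreal_leI)
      then show ?thesis using True n d by (simp add: ennreal_mult[symmetric])
    qed simp
  qed
  finally have "ennreal (1 / d) \<le> 4 * (\<integral>\<^sup>+r. ennreal (r\<^sup>2) * indicator {0<..} r *
    ennreal (indicator (cball 0 2) (r *\<^sub>R \<omega> - c) / (norm (r *\<^sub>R \<omega> - c))\<^sup>2) \<partial>lborel)"
    by (simp add: mult_left_mono)
  then show ?thesis unfolding d_def[symmetric]
    by (rule order_trans) (rule add_increasing, simp_all)
qed

text \<open>Integrating the radial bound over \<omega> reassembles r \<omega> into a point x of
  space, giving 4 \<pi> + 4 times the integral of 1 / |x - c|^2 over |x - c| \<le> 2. That integral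
  is 8 \<pi> for every c, whence 36 \<pi>.\<close>

lemma nn_integral_sphere_inverse_dist:
  fixes c :: vec3
  shows "(\<integral>\<^sup>+\<omega>. ennreal (1 / norm (\<omega> - c)) \<partial>sphere_measure) \<le> ennreal (36 * pi)"
proof -
  let ?h = "\<lambda>x::vec3. ennreal (indicator (cball 0 2) x / (norm x)\<^sup>2)"
  have S: "emeasure (sphere_measure :: vec3 measure) (space sphere_measure) = ennreal (4 * pi)"
    by (simp add: space_sphere_measure emeasure_sphere_measure_sphere)
  have [measurable]: "cball (0::vec3) 2 \<in> sets borel" by simp
  have [measurable]: "?h \<in> borel_measurable borel" by measurable
  \<comment> \<open>The factor r^2 of the polar formula cancels the singularity, leaving 4 \<pi>
    times the length 2 of the radial interval.\<close>
  have "(\<integral>\<^sup>+x. ?h x \<partial>lborel) = (\<integral>\<^sup>+r. ennreal (4 * pi) * indicator {0..2::real} r \<partial>lborel)"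
  proof (subst nn_integral_polar, measurable, rule nn_integral_cong_AE,
      rule AE_mp[OF AE_lborel_singleton[of "0::real"]], rule AE_I2, rule impI)
    fix r :: real assume r: "r \<noteq> 0"
    have "(\<integral>\<^sup>+\<omega>. ?h (r *\<^sub>R \<omega>) \<partial>sphere_measure) = (\<integral>\<^sup>+\<omega>. ennreal (indicator {-2..2} r / r\<^sup>2) \<partial>(sphere_measure :: vec3 measure))"
      by (intro nn_integral_cong) (auto simp: space_sphere_measure indicator_def)
    also have "\<dots> = ennreal (indicator {-2..2} r / r\<^sup>2) * ennreal (4 * pi)" by (simp add: S)
    finally show "ennreal (r ^ (DIM(vec3) - 1)) * indicator {0<..} r * (\<integral>\<^sup>+\<omega>. ?h (r *\<^sub>R \<omega>) \<partial>sphere_measure) =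
      ennreal (4 * pi) * indicator {0..2} r"
      using r by (auto simp: indicator_def ennreal_mult[symmetric])
  qed
  also have "\<dots> = ennreal (8 * pi)"
    using ennreal_mult[of "4 * pi" 2] by (subst nn_integral_cmult_indicator) simp_all
  finally have h: "(\<integral>\<^sup>+x. ?h x \<partial>lborel) = ennreal (8 * pi)" .
  have ps: "pair_sigma_finite (lborel :: real measure) (sphere_measure :: vec3 measure)"
    by (intro pair_sigma_finite.intro sigma_finite_sphere_measure sigma_finite_lborel)
  have m: "(\<lambda>\<omega>. \<integral>\<^sup>+r. ennreal (r\<^sup>2) * indicator {0<..} r * ?h (r *\<^sub>R \<omega> - c) \<partial>lborel) \<in> borel_measurable borel"
    by measurable
  have "(\<integral>\<^sup>+\<omega>. ennreal (1 / norm (\<omega> - c)) \<partial>sphere_measure) \<le>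
     (\<integral>\<^sup>+\<omega>. 1 + 4 * (\<integral>\<^sup>+r. ennreal (r\<^sup>2) * indicator {0<..} r * ?h (r *\<^sub>R \<omega> - c) \<partial>lborel) \<partial>sphere_measure)"
    by (intro nn_integral_mono inverse_dist_le_radial_integral) (simp add: space_sphere_measure)
  also have "\<dots> = ennreal (4 * pi) + 4 * (\<integral>\<^sup>+\<omega>. (\<integral>\<^sup>+r. ennreal (r\<^sup>2) * indicator {0<..} r * ?h (r *\<^sub>R \<omega> - c) \<partial>lborel) \<partial>sphere_measure)"
    using measurable_sphere_measure_borel[OF m] by (subst nn_integral_add) (simp_all add: nn_integral_cmult S)
  also have "(\<integral>\<^sup>+\<omega>. (\<integral>\<^sup>+r. ennreal (r\<^sup>2) * indicator {0<..} r * ?h (r *\<^sub>R \<omega> - c) \<partial>lborel) \<partial>sphere_measure) =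
    (\<integral>\<^sup>+r. (\<integral>\<^sup>+\<omega>. ennreal (r\<^sup>2) * indicator {0<..} r * ?h (r *\<^sub>R \<omega> - c) \<partial>sphere_measure) \<partial>lborel)"
  proof (rule pair_sigma_finite.Fubini'[OF ps])
    show "(\<lambda>(r, \<omega>). ennreal (r\<^sup>2) * indicator {0<..} r * ?h (r *\<^sub>R \<omega> - c)) \<in> borel_measurable (lborel \<Otimes>\<^sub>M sphere_measure)"
      by (rule measurable_pair_sphere_measure) measurable
  qed
  also have "\<dots> = (\<integral>\<^sup>+r. ennreal (r ^ (DIM(vec3) - 1)) * indicator {0<..} r *
     (\<integral>\<^sup>+\<omega>. ?h (r *\<^sub>R \<omega> - c) \<partial>sphere_measure) \<partial>lborel)"
    by (intro nn_integral_cong, subst nn_integral_cmult) (auto intro!: measurable_sphere_measure_borel)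
  also have "\<dots> = (\<integral>\<^sup>+x. ?h (x - c) \<partial>lborel)"
    by (rule nn_integral_polar[symmetric]) measurable
  also have "\<dots> = (\<integral>\<^sup>+x. ?h x \<partial>distr lborel borel (\<lambda>x. - c + x))"
    by (subst nn_integral_distr) simp_all
  also have "\<dots> = (\<integral>\<^sup>+x. ?h x \<partial>lborel)" by (simp only: lborel_distr_plus)
  finally show ?thesis unfolding h
    using ennreal_plus[of "4 * pi" "4 * (8 * pi)"] ennreal_mult[of 4 "8 * pi"] by simp
qed

subsection \<open>Centre-of-mass coordinates\<close>

lemma energy_pos [simp]: "energy p > 0"
  by (simp add: energy_def add_pos_nonneg)

lemma energy_nonzero [simp]: "energy p \<noteq> 0"
  using energy_pos[of p] by linarith

lemma energy_ge_one: "energy p \<ge> 1"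
  by (simp add: energy_def)

lemma energy_sq: "(energy p)\<^sup>2 = 1 + p \<bullet> p"
  by (simp add: energy_def power2_norm_eq_inner)

text \<open>The difference of the squares of p0 q0 and |p| |q| + 1 is (|p| - |q|)^2; Cauchy-Schwarz
  does the rest. This makes g^2 nonnegative, so the root in \<open>rel_momentum\<close> is a genuine
  one.\<close>

lemma abs_inner_add_one_le_energy: "\<bar>p \<bullet> q\<bar> + 1 \<le> energy p * energy q"
proof (rule power2_le_imp_le)
  have "(energy p * energy q)\<^sup>2 - (norm p * norm q + 1)\<^sup>2 = (norm p - norm q)\<^sup>2"
    unfolding power_mult_distrib energy_sq power2_norm_eq_inner[symmetric]
    by (simp add: power2_eq_square algebra_simps)
  then have "(norm p * norm q + 1)\<^sup>2 \<le> (energy p * energy q)\<^sup>2"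
    by (smt (verit) zero_le_power2)
  moreover have "(\<bar>p \<bullet> q\<bar> + 1)\<^sup>2 \<le> (norm p * norm q + 1)\<^sup>2"
    by (intro power_mono add_mono Cauchy_Schwarz_ineq2) auto
  ultimately show "(\<bar>p \<bullet> q\<bar> + 1)\<^sup>2 \<le> (energy p * energy q)\<^sup>2" by linarith
  show "0 \<le> energy p * energy q" by (simp add: less_imp_le)
qed

lemma lorentz_four: "lorentz (four p) (four q) = p \<bullet> q - energy p * energy q"
  by (simp add: lorentz_def four_def)

lemma lorentz_four_diff_self: "lorentz (four p - four q) (four p - four q) = 2 * (energy p * energy q - p \<bullet> q - 1)"
proof -
  have "lorentz (four p - four q) (four p - four q) =
    p \<bullet> p + q \<bullet> q - 2 * (p \<bullet> q) - (energy p)\<^sup>2 - (energy q)\<^sup>2 + 2 * (energy p * energy q)"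
    by (simp add: lorentz_def four_def inner_diff_left inner_diff_right inner_commute power2_eq_square algebra_simps)
  then show ?thesis by (simp add: energy_sq)
qed

lemma rel_momentum_four_sq:
  "(rel_momentum (four p) (four q))\<^sup>2 = 2 * (energy p * energy q - p \<bullet> q - 1)"
  using abs_inner_add_one_le_energy[of p q] by (simp add: rel_momentum_def lorentz_four_diff_self)

lemma rel_momentum_four_nonneg: "rel_momentum (four p) (four q) \<ge> 0"
  using abs_inner_add_one_le_energy[of p q] by (simp add: rel_momentum_def lorentz_four_diff_self)

lemma s_inv_four: "s_inv (four p) (four q) = (rel_momentum (four p) (four q))\<^sup>2 + 4"
  by (simp add: rel_momentum_four_sq s_inv_def lorentz_four)

text \<open>The total four-momentum has Lorentz square -s.\<close>

lemma energy_add_sq: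
  "(energy p + energy q)\<^sup>2 = s_inv (four p) (four q) + (p + q) \<bullet> (p + q)"
  by (simp add: power2_sum energy_sq s_inv_def lorentz_four inner_add_left inner_add_right inner_commute)

text \<open>From \<open>g\<^sup>2 = 2 (|p - q|\<^sup>2 + |p \<times> q|\<^sup>2) / (p\<^sup>0 q\<^sup>0 + p \<cdot> q + 1)\<close>.\<close>

lemma rel_momentum_ge:
  "norm (p - q) \<le> sqrt (energy p * energy q) * rel_momentum (four p) (four q)"
proof (rule power2_le_imp_le)
  let ?e = "energy p * energy q" and ?i = "p \<bullet> q"
  have cs: "?i\<^sup>2 \<le> (p \<bullet> p) * (q \<bullet> q)" by (rule Cauchy_Schwarz_ineq)
  have "?e\<^sup>2 = (1 + p \<bullet> p) * (1 + q \<bullet> q)" by (simp add: power_mult_distrib energy_sq)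
  then have "(?e - ?i - 1) * (?e + ?i + 1) = (p \<bullet> p) * (q \<bullet> q) - ?i\<^sup>2 + (p \<bullet> p) + (q \<bullet> q) - 2 * ?i"
    by (simp add: power2_eq_square algebra_simps)
  then have "p \<bullet> p + q \<bullet> q - 2 * ?i \<le> (?e - ?i - 1) * (?e + ?i + 1)" using cs by linarith
  \<comment> \<open>The first factor is g^2 / 2 \<ge> 0, and p . q + 1 \<le> p0 q0 bounds the
    second.\<close>
  also have "\<dots> \<le> (?e - ?i - 1) * (2 * ?e)"
    using abs_inner_add_one_le_energy[of p q] by (intro mult_left_mono) auto
  finally show "(norm (p - q))\<^sup>2 \<le> (sqrt ?e * rel_momentum (four p) (four q))\<^sup>2"
    by (simp add: power_mult_distrib rel_momentum_four_sq power2_norm_eq_inner inner_diff_left inner_diff_right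
        inner_commute less_imp_le algebra_simps)
  show "0 \<le> sqrt ?e * rel_momentum (four p) (four q)"
    by (simp add: rel_momentum_four_nonneg less_imp_le)
qed

section \<open>The boost and the collision map\<close>

text \<open>Centre-of-mass coordinates for pairs \<open>(p, q)\<close> of total momentum \<open>P = p + q\<close>: \<open>boost P k\<close> is
  the momentum \<open>p\<close> whose image in the centre-of-mass frame is \<open>k\<close>, and \<open>total_energy P k\<close> is
  \<open>p\<^sup>0 + q\<^sup>0\<close>. The factor \<open>(\<gamma> - 1) / |P|\<^sup>2\<close> is written without the singularity at \<open>P = 0\<close>.\<close>

definition total_energy :: "vec3 \<Rightarrow> vec3 \<Rightarrow> real" where
  "total_energy P k = sqrt (4 * (energy k)\<^sup>2 + P \<bullet> P)"

definition boost :: "vec3 \<Rightarrow> vec3 \<Rightarrow> vec3" where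
  "boost P k = (1 / 2) *\<^sub>R P + k + (P \<bullet> k / (2 * energy k * (total_energy P k + 2 * energy k))) *\<^sub>R P"

lemma total_energy_sq: "(total_energy P k)\<^sup>2 = 4 * (energy k)\<^sup>2 + P \<bullet> P"
  by (simp add: total_energy_def)

lemma total_energy_pos [simp]: "total_energy P k > 0"
  by (simp add: total_energy_def add_pos_nonneg[OF mult_pos_pos])

lemma total_energy_minus [simp]: "total_energy P (- k) = total_energy P k"
  and energy_minus [simp]: "energy (- k) = energy k"
  by (simp_all add: total_energy_def energy_def)

text \<open>In the centre-of-mass frame the two momenta are k and -k, so reflecting k transfers
  statements about p to q.\<close>

lemma boost_minus: "boost P (- k) = P - boost P k"
proof -
  have "P = (1 / 2) *\<^sub>R P + (1 / 2) *\<^sub>R P" by (simp flip: scaleR_left_distrib)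
  then show ?thesis by (simp add: boost_def algebra_simps)
qed

text \<open>Cauchy-Schwarz, with strictly positive terms to spare. It gives the sign needed to
  extract a square root in \<open>energy_boost\<close>.\<close>

lemma inner_less_total_energy: "\<bar>P \<bullet> k\<bar> < total_energy P k * energy k"
proof (rule power2_less_imp_less)
  have "(total_energy P k * energy k)\<^sup>2 = (P \<bullet> P) * (k \<bullet> k) + (P \<bullet> P + 4 * (energy k)\<^sup>2 * (energy k)\<^sup>2)"
    by (simp add: power_mult_distrib total_energy_sq energy_sq algebra_simps)
  moreover have "0 < P \<bullet> P + 4 * (energy k)\<^sup>2 * (energy k)\<^sup>2"
    by (intro add_nonneg_pos mult_pos_pos) simp_all
  ultimately show "\<bar>P \<bullet> k\<bar>\<^sup>2 < (total_energy P k * energy k)\<^sup>2"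
    using Cauchy_Schwarz_ineq[of P k] by simp
  show "0 \<le> total_energy P k * energy k" by (simp add: less_imp_le)
qed

text \<open>Read b as |P|^2, m as P . k and \<phi> as the coefficient m / (2 E (S + 2 E)). The left
  sides are then P . (k + \<phi> P) and |k + \<phi> P|^2 - |k|^2; the factorization b = (S + 2 E) (S
  - 2 E) cancels the denominator.\<close>

lemma boost_identities:
  fixes m S E b :: real
  assumes "E > 0" "S > 0" and b: "b = S\<^sup>2 - 4 * E\<^sup>2"
  shows "m / (2 * E * (S + 2 * E)) * b + m = m * S / (2 * E)"
    and "(m / (2 * E * (S + 2 * E)))\<^sup>2 * b + 2 * (m / (2 * E * (S + 2 * E))) * m = m\<^sup>2 / (4 * E\<^sup>2)"
proof -
  have pos: "E \<noteq> 0" "S + 2 * E \<noteq> 0" using assms by auto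
  have b': "b = (S + 2 * E) * (S - 2 * E)" unfolding b by (simp add: power2_eq_square algebra_simps)
  show "m / (2 * E * (S + 2 * E)) * b + m = m * S / (2 * E)"
    unfolding b' using pos by (simp add: divide_simps) (simp add: algebra_simps)
  show "(m / (2 * E * (S + 2 * E)))\<^sup>2 * b + 2 * (m / (2 * E * (S + 2 * E))) * m = m\<^sup>2 / (4 * E\<^sup>2)"
    unfolding b' using pos by (simp add: divide_simps power2_eq_square) (simp add: algebra_simps)
qed

text \<open>This is the time component \<gamma> (k0 + v . k) of the Lorentz boost with velocity v =
  P / S and \<gamma> = S / (2 k0), where S is the total energy. It is verified by comparing
  squares.\<close>

lemma energy_boost: "energy (boost P k) = total_energy P k / 2 + P \<bullet> k / (2 * energy k)"
proof -
  define E where "E = energy k"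
  define S where "S = total_energy P k"
  define m where "m = P \<bullet> k"
  define \<phi> where "\<phi> = m / (2 * E * (S + 2 * E))"
  have pos: "E > 0" "S > 0" by (simp_all add: E_def S_def)
  have PP: "P \<bullet> P = S\<^sup>2 - 4 * E\<^sup>2" by (simp add: S_def E_def total_energy_sq)
  have kk: "k \<bullet> k = E\<^sup>2 - 1" by (simp add: E_def energy_sq)
  have T: "boost P k = (1 / 2) *\<^sub>R P + k + \<phi> *\<^sub>R P" by (simp add: boost_def \<phi>_def E_def S_def m_def)
  have "boost P k \<bullet> boost P k = (P \<bullet> P) / 4 + k \<bullet> k + (\<phi> * (P \<bullet> P) + m) + (\<phi>\<^sup>2 * (P \<bullet> P) + 2 * \<phi> * m)"
    unfolding T m_def
    by (simp add: inner_add_left inner_add_right inner_commute power2_eq_square algebra_simps)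
  also have "\<dots> = (S\<^sup>2 - 4 * E\<^sup>2) / 4 + (E\<^sup>2 - 1) + m * S / (2 * E) + m\<^sup>2 / (4 * E\<^sup>2)"
    using boost_identities[OF pos PP, of m] by (simp add: \<phi>_def PP kk)
  also have "\<dots> = (S / 2 + m / (2 * E))\<^sup>2 - 1"
    using pos by (simp add: power2_sum power_divide power_mult_distrib diff_divide_distrib)
  finally have "(energy (boost P k))\<^sup>2 = (S / 2 + m / (2 * E))\<^sup>2" by (simp add: energy_sq)
  moreover have "- m < S * E" using inner_less_total_energy[of P k] by (simp add: m_def S_def E_def)
  then have "0 \<le> S / 2 + m / (2 * E)" using pos by (simp add: field_simps)
  ultimately show ?thesis unfolding E_def S_def m_def
    using power2_eq_imp_eq energy_pos less_imp_le by metis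
qed

lemma energy_diff_boost: "energy (P - boost P k) = total_energy P k / 2 - P \<bullet> k / (2 * energy k)"
  using energy_boost[of P "- k"] by (simp add: boost_minus)

lemma energy_boost_add: "energy (boost P k) + energy (P - boost P k) = total_energy P k"
  by (simp add: energy_boost energy_diff_boost)

lemma s_inv_boost: "s_inv (four (boost P k)) (four (P - boost P k)) = 4 * (energy k)\<^sup>2"
  using energy_add_sq[of "boost P k" "P - boost P k"] by (simp add: energy_boost_add total_energy_sq)

lemma rel_momentum_boost: "rel_momentum (four (boost P k)) (four (P - boost P k)) = 2 * norm k"
proof (rule power2_eq_imp_eq)
  show "(rel_momentum (four (boost P k)) (four (P - boost P k)))\<^sup>2 = (2 * norm k)\<^sup>2"
    using s_inv_boost[of P k]
    by (simp add: s_inv_four energy_sq power_mult_distrib power2_norm_eq_inner)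
qed (simp_all add: rel_momentum_four_nonneg)

lemma moller_boost:
  "moller (boost P k) (P - boost P k) =
     4 * norm k * energy k / (energy (boost P k) * energy (P - boost P k))"
  by (simp add: moller_def rel_momentum_boost s_inv_boost real_sqrt_mult less_imp_le)

lemma energy_scaleR_norm:
  assumes "norm \<omega> = 1"
  shows "energy (norm k *\<^sub>R \<omega>) = energy k" "total_energy P (norm k *\<^sub>R \<omega>) = total_energy P k"
  using assms by (simp_all add: energy_def total_energy_def)

text \<open>Here g / 2 = |k| and \<gamma> = S / (2 E), and |P|^2 = (S - 2 E) (S + 2 E) turns
  (\<gamma> - 1) / |P|^2 into 1 / (2 E (S + 2 E)). At P = 0 the default value of the quotient is
  harmless because it multiplies P.\<close>

lemma collision_shift_boost:
  assumes "norm \<omega> = 1"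
  shows "(1 / 2) *\<^sub>R P + collision_shift (boost P k) (P - boost P k) \<omega> = boost P (norm k *\<^sub>R \<omega>)"
proof -
  define E where "E = energy k"
  define S where "S = total_energy P k"
  have pos: "E > 0" "S > 0" by (simp_all add: E_def S_def)
  have PP: "P \<bullet> P = (S - 2 * E) * (S + 2 * E)"
    using total_energy_sq[of P k] by (simp add: S_def E_def power2_eq_square algebra_simps)
  have "((S / (2 * E) - 1) * ((P \<bullet> \<omega>) / (P \<bullet> P))) *\<^sub>R P = (P \<bullet> \<omega> / (2 * E * (S + 2 * E))) *\<^sub>R P"
  proof (cases "P = 0")
    case False
    then have "S - 2 * E \<noteq> 0" using PP by (metis inner_eq_zero_iff mult_zero_left)
    then show ?thesis unfolding PP using pos by (simp add: divide_simps)
  qed simp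
  note * = this
  have "collision_shift (boost P k) (P - boost P k) \<omega> =
      norm k *\<^sub>R (\<omega> + ((S / (2 * E) - 1) * ((P \<bullet> \<omega>) / (P \<bullet> P))) *\<^sub>R P)"
    by (simp add: collision_shift_def Let_def energy_boost_add s_inv_boost rel_momentum_boost
      real_sqrt_mult less_imp_le power2_norm_eq_inner S_def E_def)
  then show ?thesis
    unfolding * using assms
    by (simp add: boost_def energy_scaleR_norm scaleR_add_right flip: E_def S_def)
qed

lemma post_boost:
  assumes "norm \<omega> = 1"
  shows "post_p (boost P k) (P - boost P k) \<omega> = boost P (norm k *\<^sub>R \<omega>)"
    and "post_q (boost P k) (P - boost P k) \<omega> = P - boost P (norm k *\<^sub>R \<omega>)"
proof -
  show *: "post_p (boost P k) (P - boost P k) \<omega> = boost P (norm k *\<^sub>R \<omega>)"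
    using collision_shift_boost[OF assms] by (simp add: post_p_def)
  have "P = (1 / 2) *\<^sub>R P + (1 / 2) *\<^sub>R P" by (simp flip: scaleR_left_distrib)
  then show "post_q (boost P k) (P - boost P k) \<omega> = P - boost P (norm k *\<^sub>R \<omega>)"
    unfolding *[symmetric] by (simp add: post_p_def post_q_def algebra_simps)
qed

section \<open>Bijectivity of the boost\<close>

text \<open>Expanding the square adds only nonnegative terms. On a sphere |k| = const the boost is a
  translate of such a map, hence expanding there.\<close>

lemma norm_add_inner_scaleR_ge:
  fixes P x :: "'a::real_inner"
  assumes "t \<ge> 0"
  shows "norm x \<le> norm (x + (t * (P \<bullet> x)) *\<^sub>R P)"
proof (rule power2_le_imp_le)
  have "(norm (x + (t * (P \<bullet> x)) *\<^sub>R P))\<^sup>2 =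
     (norm x)\<^sup>2 + 2 * t * (P \<bullet> x)\<^sup>2 + (t * (P \<bullet> x))\<^sup>2 * (P \<bullet> P)"
    unfolding power2_norm_eq_inner
    by (simp add: inner_add_left inner_add_right inner_commute power2_eq_square algebra_simps)
  then show "(norm x)\<^sup>2 \<le> (norm (x + (t * (P \<bullet> x)) *\<^sub>R P))\<^sup>2"
    using assms by simp
qed simp

text \<open>For fixed P, the momentum p determines p0 + q0, hence the energy of k and the
  coefficient t. Once t is common to k and l, the expanding property forces k = l.\<close>

lemma inj_boost: "inj (boost P)"
proof (rule injI)
  fix k l assume eq: "boost P k = boost P l"
  then have S: "total_energy P k = total_energy P l" using energy_boost_add by metis
  then have "(energy k)\<^sup>2 = (energy l)\<^sup>2" using total_energy_sq[of P k] total_energy_sq[of P l] by simp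
  then have E: "energy k = energy l" by (simp add: less_imp_le)
  define t where "t = 1 / (2 * energy l * (total_energy P l + 2 * energy l))"
  have "t \<ge> 0" by (simp add: t_def less_imp_le add_pos_pos)
  moreover have "k - l + (t * (P \<bullet> (k - l))) *\<^sub>R P = 0"
    using eq by (simp add: boost_def S E t_def inner_diff_right diff_divide_distrib scaleR_left_diff_distrib algebra_simps)
  ultimately show "k = l" using norm_add_inner_scaleR_ge[of t "k - l" P] by simp
qed

lemma surj_boost: "surj (boost P)"
proof -
  have "\<exists>k. boost P k = p" for p
  proof -
  define q where "q = P - p"
  define S where "S = energy p + energy q"
  define E where "E = sqrt (s_inv (four p) (four q)) / 2"
  define d where "d = p - (1 / 2) *\<^sub>R P"
  \<comment> \<open>This is the inverse boost. The linear map x + (P . x) P / (2 E (S + 2 E))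
    stretches P by S / (2 E), so its inverse has coefficient -1 / (S (S + 2 E)); it is applied to d
    = (p - q) / 2.\<close>
  define k where "k = d - ((P \<bullet> d) / (S * (S + 2 * E))) *\<^sub>R P"
  have s: "s_inv (four p) (four q) > 0" by (simp add: s_inv_four add_nonneg_pos)
  have pos: "S > 0" "E > 0" using s by (simp_all add: S_def E_def add_pos_pos)
  have EE: "4 * E\<^sup>2 = s_inv (four p) (four q)" using s by (simp add: E_def power_divide)
  have PP': "P \<bullet> P = S\<^sup>2 - 4 * E\<^sup>2" unfolding EE using energy_add_sq[of p q] by (simp add: S_def q_def)
  then have PP: "P \<bullet> P = (S + 2 * E) * (S - 2 * E)" by (simp add: power2_eq_square algebra_simps)
  have "2 * (P \<bullet> d) = p \<bullet> p - q \<bullet> q"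
    by (simp add: d_def q_def inner_diff_left inner_diff_right inner_commute)
  also have "\<dots> = (energy p)\<^sup>2 - (energy q)\<^sup>2" by (simp add: energy_sq)
  also have "\<dots> = S * (energy p - energy q)" by (simp add: S_def power2_eq_square algebra_simps)
  finally have Pd: "P \<bullet> d = ((energy p - energy q) / 2) * S" by (simp add: mult.commute)
  have dd: "4 * (d \<bullet> d) = 2 * (p \<bullet> p) + 2 * (q \<bullet> q) - P \<bullet> P"
    by (simp add: d_def q_def inner_diff_left inner_diff_right inner_commute)
  \<comment> \<open>Invariance of the Lorentz length: (P . d) / S is the time component (p0 - q0) /
    2 belonging to d, and k has time component 0.\<close>
  have "k \<bullet> k = d \<bullet> d - (P \<bullet> d)\<^sup>2 / S\<^sup>2"
  proof -
    have "k \<bullet> k = d \<bullet> d - 2 * (P \<bullet> d) * ((P \<bullet> d) / (S * (S + 2 * E))) + ((P \<bullet> d) / (S * (S + 2 * E)))\<^sup>2 * (P \<bullet> P)"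
      by (simp add: k_def inner_diff_left inner_diff_right inner_commute power2_eq_square)
    also have "\<dots> = d \<bullet> d - (P \<bullet> d)\<^sup>2 / S\<^sup>2"
      unfolding PP using pos by (simp add: divide_simps power2_eq_square) (simp add: algebra_simps)
    finally show ?thesis .
  qed
  also have "(P \<bullet> d)\<^sup>2 / S\<^sup>2 = ((energy p - energy q) / 2)\<^sup>2"
    unfolding Pd power_mult_distrib using pos by simp
  finally have "4 * (k \<bullet> k + 1) = 2 * (p \<bullet> p + 1) + 2 * (q \<bullet> q + 1) - (energy p - energy q)\<^sup>2 - P \<bullet> P"
    using dd by (simp add: power_divide)
  also have "\<dots> = S\<^sup>2 - P \<bullet> P"
    using energy_sq[of p] energy_sq[of q] by (simp add: S_def power2_eq_square algebra_simps)
  finally have "k \<bullet> k + 1 = E\<^sup>2" using PP' by simp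
  then have Ek: "energy k = E" using pos by (simp add: energy_def power2_norm_eq_inner add.commute)
  then have Sk: "total_energy P k = S"
    using PP' pos by (simp add: total_energy_def)
  have "P \<bullet> k = P \<bullet> d * (2 * E / S)"
    unfolding k_def inner_diff_right inner_scaleR_right PP using pos by (simp add: divide_simps) (simp add: algebra_simps)
  then have "P \<bullet> k / (2 * E * (S + 2 * E)) = (P \<bullet> d) / (S * (S + 2 * E))"
    using pos by (simp add: divide_simps)
  then have "boost P k = p" unfolding boost_def Ek Sk by (simp add: k_def d_def)
  then show ?thesis ..
  qed
  then show ?thesis by (metis surj_def)
qed

section \<open>The scattering angle\<close>

text \<open>Lorentz invariance: in the centre-of-mass frame the two difference vectors are (0, 2 k)
  and (0, 2 l).\<close>

lemma lorentz_four_diff_boost: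
  fixes P k \<omega> :: vec3
  assumes "norm \<omega> = 1"
  defines "l \<equiv> norm k *\<^sub>R \<omega>"
  shows "lorentz (four (boost P k) - four (P - boost P k)) (four (boost P l) - four (P - boost P l))
    = 4 * (k \<bullet> l)"
proof -
  define E where "E = energy k"
  define S where "S = total_energy P k"
  define t where "t = 1 / (2 * E * (S + 2 * E))"
  have pos: "E > 0" "S > 0" by (simp_all add: E_def S_def)
  have PP: "P \<bullet> P = S\<^sup>2 - 4 * E\<^sup>2" by (simp add: S_def E_def total_energy_sq)
  have l: "energy l = E" "total_energy P l = S"
    using energy_scaleR_norm[OF assms(1)] by (simp_all add: l_def E_def S_def)
  have bk: "boost P k = (1 / 2) *\<^sub>R P + k + (t * (P \<bullet> k)) *\<^sub>R P"
    and bl: "boost P l = (1 / 2) *\<^sub>R P + l + (t * (P \<bullet> l)) *\<^sub>R P"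
    by (simp_all add: boost_def l t_def E_def S_def)
  have *: "boost P k - (P - boost P k) = 2 *\<^sub>R k + (2 * t * (P \<bullet> k)) *\<^sub>R P"
    "boost P l - (P - boost P l) = 2 *\<^sub>R l + (2 * t * (P \<bullet> l)) *\<^sub>R P"
    by (simp_all add: vec_eq_iff bk bl field_simps)
  have "lorentz (four (boost P k) - four (P - boost P k)) (four (boost P l) - four (P - boost P l)) =
     (boost P k - (P - boost P k)) \<bullet> (boost P l - (P - boost P l)) - (P \<bullet> k) * (P \<bullet> l) / E\<^sup>2"
    by (simp add: lorentz_def four_def energy_boost energy_diff_boost l power2_eq_square flip: E_def S_def)
  also have "\<dots> = 4 * (k \<bullet> l) + (P \<bullet> k) * (P \<bullet> l) * (4 * (t\<^sup>2 * (P \<bullet> P) + 2 * t) - 1 / E\<^sup>2)"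
    unfolding * by (simp add: inner_add_left inner_add_right inner_commute power2_eq_square algebra_simps)
  \<comment> \<open>This is exactly the value that cancels the contribution of the time
    components.\<close>
  also have "t\<^sup>2 * (P \<bullet> P) + 2 * t = 1 / (4 * E\<^sup>2)"
    using boost_identities(2)[OF pos PP, of 1] by (simp add: t_def)
  finally show ?thesis by simp
qed

text \<open>The argument of \<open>arccos\<close> is the cosine of the angle between k and \<omega>,
  or 0 when k = 0, hence lies in [-1, 1]. The kernel bounds are available only for angles in
  [0, \<pi>].\<close>

lemma scattering_angle_range:
  assumes "norm \<omega> = 1"
  shows "scattering_angle p q \<omega> \<in> {0..pi}"
proof -
  define P where "P = p + q"
  obtain k where p: "p = boost P k" using surj_boost by (metis surjD)
  have q: "q = P - p" by (simp add: P_def)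
  have "\<bar>k \<bullet> (norm k *\<^sub>R \<omega>)\<bar> \<le> (norm k)\<^sup>2"
    using Cauchy_Schwarz_ineq2[of k "norm k *\<^sub>R \<omega>"] assms by (simp add: power2_eq_square)
  then have "\<bar>4 * (k \<bullet> (norm k *\<^sub>R \<omega>)) / (2 * norm k)\<^sup>2\<bar> \<le> 1"
    by (simp add: divide_simps power_mult_distrib)
  then show ?thesis
    unfolding scattering_angle_def q p post_boost[OF assms] lorentz_four_diff_boost[OF assms]
      rel_momentum_boost
    by (simp only: atLeastAtMost_iff abs_le_iff minus_le_iff arccos_lbound arccos_ubound simp_thms)
qed

section \<open>The Jacobian and the change of variables\<close>

definition boost_jacobian :: "vec3 \<Rightarrow> vec3 \<Rightarrow> real" where
  "boost_jacobian P k =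
     2 * energy (boost P k) * energy (P - boost P k) / (energy k * total_energy P k)"

text \<open>The matrix determinant lemma in dimension three; the derivative of the boost is such a
  rank-one perturbation of the identity.\<close>

lemma det_add_rank_one:
  fixes P v :: vec3
  shows "det (matrix (\<lambda>h. h + (v \<bullet> h) *\<^sub>R P)) = 1 + v \<bullet> P"
  by (simp add: det_3 matrix_def inner_vec_def sum_3 axis_def algebra_simps)

lemma has_derivative_energy:
  "(energy has_derivative (\<lambda>h. k \<bullet> h / energy k)) (at k)"
proof -
  have e: "energy = (\<lambda>k. sqrt (1 + k \<bullet> k))" by (simp add: fun_eq_iff energy_def power2_norm_eq_inner)
  have "1 + k \<bullet> k > 0" by (simp add: add_pos_nonneg)
  then show ?thesis unfolding e
    by (auto intro!: derivative_eq_intros simp: inner_commute field_simps)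
qed

lemma has_derivative_total_energy:
  "(total_energy P has_derivative (\<lambda>h. 4 * (k \<bullet> h) / total_energy P k)) (at k)"
proof -
  have "4 * (energy k)\<^sup>2 + P \<bullet> P > 0" by (simp add: add_pos_nonneg[OF mult_pos_pos])
  then show ?thesis unfolding total_energy_def[abs_def]
    by (auto intro!: derivative_eq_intros has_derivative_energy simp: field_simps)
qed

text \<open>Gradient of \<open>k \<mapsto> P \<cdot> k / B\<close>, where \<open>B = 2 E (S + 2 E)\<close> has gradient
  \<open>(2 (S + 2 E)\<^sup>2 / (E S)) k\<close>.\<close>

definition boost_gradient :: "vec3 \<Rightarrow> vec3 \<Rightarrow> vec3" where
  "boost_gradient P k = (let E = energy k; S = total_energy P k; B = 2 * E * (S + 2 * E) in
     (1 / B) *\<^sub>R P - ((P \<bullet> k) * (2 * (S + 2 * E)\<^sup>2 / (E * S)) / B\<^sup>2) *\<^sub>R k)"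

lemma has_derivative_boost:
  "(boost P has_derivative (\<lambda>h. h + (boost_gradient P k \<bullet> h) *\<^sub>R P)) (at k)"
proof -
  define E where "E = energy k"
  define S where "S = total_energy P k"
  have pos: "E > 0" "S > 0" by (simp_all add: E_def S_def)
  define B where "B = 2 * E * (S + 2 * E)"
  define D where "D = 2 * (S + 2 * E)\<^sup>2 / (E * S)"
  have B: "B > 0" using pos by (simp add: B_def)
  have 1: "((\<lambda>k. 2 * energy k * (total_energy P k + 2 * energy k)) has_derivative
      (\<lambda>h. D * (k \<bullet> h))) (at k)"
    unfolding D_def
    by (rule has_derivative_eq_rhs, (rule derivative_intros has_derivative_energy has_derivative_total_energy)+)
      (use pos in \<open>simp add: fun_eq_iff field_simps power2_eq_square flip: E_def S_def\<close>)
  have bg: "boost_gradient P k = (1 / B) *\<^sub>R P - ((P \<bullet> k) * D / B\<^sup>2) *\<^sub>R k"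
    by (simp add: boost_gradient_def Let_def B_def D_def E_def S_def)
  have 2: "((\<lambda>k. P \<bullet> k / (2 * energy k * (total_energy P k + 2 * energy k))) has_derivative
      (\<lambda>h. boost_gradient P k \<bullet> h)) (at k)"
  proof (rule has_derivative_eq_rhs)
    show "((\<lambda>k. P \<bullet> k / (2 * energy k * (total_energy P k + 2 * energy k))) has_derivative
      (\<lambda>h. - (P \<bullet> k) * (inverse B * (D * (k \<bullet> h)) * inverse B) + (P \<bullet> h) / B)) (at k)"
      using has_derivative_divide[OF has_derivative_inner_right[OF has_derivative_ident, of P] 1] B
      unfolding E_def[symmetric] S_def[symmetric] B_def[symmetric] by simp
    show "(\<lambda>h. - (P \<bullet> k) * (inverse B * (D * (k \<bullet> h)) * inverse B) + (P \<bullet> h) / B) =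
        (\<lambda>h. boost_gradient P k \<bullet> h)"
      unfolding bg using B by (simp add: fun_eq_iff inner_diff_left field_simps power2_eq_square)
  qed
  show ?thesis unfolding boost_def[abs_def]
    by (rule has_derivative_eq_rhs, (rule derivative_intros 2)+) (simp add: fun_eq_iff)
qed

text \<open>Identifies the determinant of the derivative. With m = P . k it reduces to S / (2 E) -
  m^2 / (2 E^3 S), a difference of squares whose two factors are the energies of p and q.\<close>

lemma boost_gradient_inner: "1 + boost_gradient P k \<bullet> P = boost_jacobian P k"
proof -
  define E where "E = energy k"
  define S where "S = total_energy P k"
  define m where "m = P \<bullet> k"
  have pos: "E > 0" "S > 0" by (simp_all add: E_def S_def)
  have PP: "P \<bullet> P = (S + 2 * E) * (S - 2 * E)"
    using total_energy_sq[of P k] by (simp add: S_def E_def power2_eq_square algebra_simps)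
  have "S + 2 * E > 0" using pos by simp
  then obtain w where w: "S + 2 * E = w" "w > 0" by blast
  have "1 + boost_gradient P k \<bullet> P =
     1 + (S - 2 * E) / (2 * E) - m\<^sup>2 * (2 * w\<^sup>2 / (E * S)) / (2 * E * w)\<^sup>2"
    using pos less_imp_neq[OF w(2)]
    by (simp add: boost_gradient_def Let_def inner_diff_left PP w inner_commute[of k P] m_def
        power2_eq_square flip: E_def S_def)
  also have "\<dots> = S / (2 * E) - m\<^sup>2 / (2 * E ^ 3 * S)"
    using pos w(2) by (simp add: divide_simps power2_eq_square power3_eq_cube)
  also have "\<dots> = 2 * (S / 2 + m / (2 * E)) * (S / 2 - m / (2 * E)) / (E * S)"
    using pos by (simp add: divide_simps power2_eq_square power3_eq_cube) (simp add: algebra_simps)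
  finally show ?thesis
    by (simp add: boost_jacobian_def energy_boost energy_diff_boost E_def S_def m_def)
qed

lemma boost_jacobian_pos: "boost_jacobian P k > 0"
  by (simp add: boost_jacobian_def)

lemma borel_measurable_energy [measurable]: "energy \<in> borel_measurable borel"
  unfolding energy_def[abs_def] by measurable

lemma borel_measurable_boost [measurable]:
  assumes [measurable]: "f \<in> borel_measurable M" "g \<in> borel_measurable M"
  shows "(\<lambda>x. boost (f x) (g x)) \<in> borel_measurable M"
    and "(\<lambda>x. total_energy (f x) (g x)) \<in> borel_measurable M"
    and "(\<lambda>x. boost_jacobian (f x) (g x)) \<in> borel_measurable M"
  unfolding boost_jacobian_def boost_def total_energy_def by measurable

text \<open>The image under g of the measure with density |det g'| agrees with Lebesgue measure on
  boxes, hence everywhere. Integrating f against this image gives the formula for every nonnegative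
  Borel function.\<close>

lemma nn_integral_change_of_variables_bij:
  fixes g :: "real ^ 'n::{finite,wellorder} \<Rightarrow> real ^ 'n::_"
  assumes der: "\<And>x. (g has_derivative g' x) (at x)" and bij: "bij g"
    and [measurable]: "(\<lambda>x. det (matrix (g' x))) \<in> borel_measurable borel" "f \<in> borel_measurable borel"
  shows "(\<integral>\<^sup>+y. f y \<partial>lborel) = (\<integral>\<^sup>+x. ennreal \<bar>det (matrix (g' x))\<bar> * f (g x) \<partial>lborel)"
proof -
  have "continuous_on UNIV g"
    using der by (meson continuous_at_imp_continuous_on has_derivative_continuous)
  then have [measurable]: "g \<in> borel_measurable borel" by (rule borel_measurable_continuous_onI)
  let ?M = "distr (density lborel (\<lambda>x. ennreal \<bar>det (matrix (g' x))\<bar>)) borel g"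
  have "lborel = ?M"
  proof (rule lborel_eqI)
    fix l u :: "real ^ 'n::{finite,wellorder}" assume le: "\<And>b. b \<in> Basis \<Longrightarrow> l \<bullet> b \<le> u \<bullet> b"
    let ?A = "box l u"
    have pre [measurable]: "g -` ?A \<in> sets borel" by (intro measurable_sets_borel[of g borel]) simp_all
    \<comment> \<open>Since g is onto, the box is the image of its preimage, so the formula for the
      measure of a differentiable injective image applies to it.\<close>
    have "((\<lambda>x. \<bar>det (matrix (g' x))\<bar>) has_integral measure lebesgue ?A) (g -` ?A)"
    proof (subst has_measure_differentiable_image[symmetric, where f = g])
      show "g ` (g -` ?A) \<in> lmeasurable \<and> measure lebesgue (g ` (g -` ?A)) = measure lebesgue ?A"
        using bij by (simp add: bij_is_surj)
    qed (use pre bij in \<open>auto intro: has_derivative_at_withinI der inj_on_subset bij_is_inj\<close>)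
    then have "((\<lambda>x. \<bar>det (matrix (g' x))\<bar> * indicator (g -` ?A) x) has_integral measure lebesgue ?A) UNIV"
      by (subst (asm) has_integral_restrict_UNIV[symmetric]) (simp add: indicator_def of_bool_def if_distrib cong: if_cong)
    then have "(\<integral>\<^sup>+x. ennreal (\<bar>det (matrix (g' x))\<bar> * indicator (g -` ?A) x) \<partial>lborel) = measure lebesgue ?A"
      by (intro nn_integral_has_integral_lborel) auto
    also have "measure lebesgue ?A = (\<Prod>b\<in>Basis. (u - l) \<bullet> b)"
      using le by simp
    finally show "emeasure ?M ?A = (\<Prod>b\<in>Basis. (u - l) \<bullet> b)"
      by (subst emeasure_distr, simp, simp, subst emeasure_density)
        (simp_all add: ennreal_mult ennreal_indicator)
  qed simp
  then have "(\<integral>\<^sup>+y. f y \<partial>lborel) = (\<integral>\<^sup>+y. f y \<partial>?M)" by simp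
  also have "\<dots> = (\<integral>\<^sup>+x. ennreal \<bar>det (matrix (g' x))\<bar> * f (g x) \<partial>lborel)"
    by (subst nn_integral_distr, simp, simp, subst nn_integral_density) simp_all
  finally show ?thesis .
qed

lemma nn_integral_boost:
  assumes "f \<in> borel_measurable borel"
  shows "(\<integral>\<^sup>+p. f p \<partial>lborel) = (\<integral>\<^sup>+k. ennreal (boost_jacobian P k) * f (boost P k) \<partial>lborel)"
proof -
  have d: "det (matrix (\<lambda>h. h + (boost_gradient P k \<bullet> h) *\<^sub>R P)) = boost_jacobian P k" for k
    unfolding det_add_rank_one by (rule boost_gradient_inner)
  show ?thesis
    using nn_integral_change_of_variables_bij[OF has_derivative_boost[of P], of f]
      inj_boost surj_boost boost_jacobian_pos[of P] assms
    by (simp add: d bij_def abs_of_pos)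
qed

subsection \<open>The weighted estimate\<close>

text \<open>On the sphere of radius |k| the boost is the restriction of an affine expanding map. The
  centre c is the preimage of b under that map divided by |k|, and need not have norm 1. The second
  property serves the case \<omega> = c, where division by the distance returns 0.\<close>

lemma norm_boost_diff_ge:
  fixes P k b :: vec3
  assumes k: "k \<noteq> 0"
  obtains c where "\<And>\<omega>. norm \<omega> = 1 \<Longrightarrow> norm k * norm (\<omega> - c) \<le> norm (boost P (norm k *\<^sub>R \<omega>) - b)"
    and "\<And>\<omega>. norm \<omega> = 1 \<Longrightarrow> \<omega> = c \<Longrightarrow> boost P (norm k *\<^sub>R \<omega>) = b"
proof -
  define t where "t = 1 / (2 * energy k * (total_energy P k + 2 * energy k))"
  have t: "t \<ge> 0" by (simp add: t_def less_imp_le add_pos_pos)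
  define v where "v = b - (1 / 2) *\<^sub>R P"
  have D: "1 + t * (P \<bullet> P) > 0" using t by (simp add: add_pos_nonneg)
  \<comment> \<open>Inverts a rank-one perturbation of the identity: w is the solution of w + t (P .
    w) P = v.\<close>
  define w where "w = v - (t * (P \<bullet> v) / (1 + t * (P \<bullet> P))) *\<^sub>R P"
  have "P \<bullet> w = P \<bullet> v / (1 + t * (P \<bullet> P))"
    using D by (simp add: w_def inner_diff_right field_simps)
  then have w: "w + (t * (P \<bullet> w)) *\<^sub>R P = v" by (simp add: w_def)
  show thesis
  proof (rule that[of "(1 / norm k) *\<^sub>R w"])
    fix \<omega> :: vec3 assume \<omega>: "norm \<omega> = 1"
    let ?x = "norm k *\<^sub>R \<omega> - w"
    have "boost P (norm k *\<^sub>R \<omega>) = (1 / 2) *\<^sub>R P + norm k *\<^sub>R \<omega> + (t * (P \<bullet> (norm k *\<^sub>R \<omega>))) *\<^sub>R P"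
      using \<omega> by (simp add: boost_def energy_scaleR_norm t_def)
    also have "\<dots> - b = ?x + (t * (P \<bullet> ?x)) *\<^sub>R P"
      using w by (simp add: v_def inner_diff_right algebra_simps)
    finally have x: "boost P (norm k *\<^sub>R \<omega>) - b = ?x + (t * (P \<bullet> ?x)) *\<^sub>R P" .
    then have "norm ?x \<le> norm (boost P (norm k *\<^sub>R \<omega>) - b)"
      using norm_add_inner_scaleR_ge[OF t, of ?x P] by simp
    moreover have "?x = norm k *\<^sub>R (\<omega> - (1 / norm k) *\<^sub>R w)" using k by (simp add: algebra_simps)
    ultimately show "norm k * norm (\<omega> - (1 / norm k) *\<^sub>R w) \<le> norm (boost P (norm k *\<^sub>R \<omega>) - b)" by simp
    assume "\<omega> = (1 / norm k) *\<^sub>R w"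
    then have "?x = 0" using k by simp
    then show "boost P (norm k *\<^sub>R \<omega>) = b" using x by simp
  qed
qed

lemma energy_boost_less: "energy (boost P k) < total_energy P k"
  using energy_boost_add[of P k] energy_pos[of "P - boost P k"] by linarith

lemma rel_momentum_self: "rel_momentum (four p) (four p) = 0"
  using rel_momentum_four_sq[of p p] energy_sq[of p] by (simp add: power2_eq_square)

text \<open>The lower bound \<open>rel_momentum_ge\<close>, multiplied by the root of the energy of
  p. If g = 0 the left side is 0 by the division convention.\<close>

lemma sqrt_energy_over_rel_momentum_le:
  "energy p powr (1 / 2) / rel_momentum (four p) (four b) \<le> energy p * sqrt (energy b) / norm (p - b)"
proof (cases "rel_momentum (four p) (four b) = 0")
  case False
  then have g: "rel_momentum (four p) (four b) > 0" using rel_momentum_four_nonneg[of p b] by simp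
  have "p \<noteq> b"
    using False rel_momentum_self by auto
  then have n: "norm (p - b) > 0" by simp
  have "sqrt (energy p) * norm (p - b) \<le> sqrt (energy p) * (sqrt (energy p * energy b) * rel_momentum (four p) (four b))"
    by (intro mult_left_mono rel_momentum_ge) (simp add: less_imp_le)
  also have "\<dots> = energy p * sqrt (energy b) * rel_momentum (four p) (four b)"
    using real_sqrt_mult_self[of "energy p"] by (simp add: real_sqrt_mult less_imp_le mult.assoc[symmetric])
  finally show ?thesis using n g by (simp add: powr_half_sqrt less_imp_le divide_simps mult_ac)
qed (simp add: less_imp_le)

text \<open>Bounding the energy of the momentum by the total energy and |p - b| from below by |k|
  |\<omega> - c| reduces the average to the reciprocal distance on the sphere. This costs 1 / |k|,
  so the prefactor |k|^2 leaves |k|.\<close>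

lemma nn_integral_sphere_weight_le:
  "ennreal ((norm k)\<^sup>2) * (\<integral>\<^sup>+\<omega>. ennreal (energy (boost P (norm k *\<^sub>R \<omega>)) powr (1 / 2) /
      rel_momentum (four (boost P (norm k *\<^sub>R \<omega>))) (four b)) \<partial>sphere_measure) \<le>
   ennreal (36 * pi * total_energy P k * sqrt (energy b) * norm k)"
proof (cases "k = 0")
  case False
  then have k: "norm k > 0" by simp
  let ?C = "total_energy P k * sqrt (energy b) / norm k"
  have C: "?C \<ge> 0" by (simp add: less_imp_le)
  obtain c where c: "\<And>\<omega>. norm \<omega> = 1 \<Longrightarrow> norm k * norm (\<omega> - c) \<le> norm (boost P (norm k *\<^sub>R \<omega>) - b)"
    "\<And>\<omega>. norm \<omega> = 1 \<Longrightarrow> \<omega> = c \<Longrightarrow> boost P (norm k *\<^sub>R \<omega>) = b"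
    using norm_boost_diff_ge[OF False, of P b] by metis
  let ?w = "\<lambda>\<omega>. ennreal (1 / norm (\<omega> - c))"
  have "(\<integral>\<^sup>+\<omega>. ennreal (energy (boost P (norm k *\<^sub>R \<omega>)) powr (1 / 2) /
      rel_momentum (four (boost P (norm k *\<^sub>R \<omega>))) (four b)) \<partial>sphere_measure) \<le>
    (\<integral>\<^sup>+\<omega>. ennreal ?C * ?w \<omega> \<partial>sphere_measure)"
  proof (rule nn_integral_mono)
    fix \<omega> :: vec3 assume "\<omega> \<in> space sphere_measure"
    then have \<omega>: "norm \<omega> = 1" by (simp add: space_sphere_measure)
    let ?p = "boost P (norm k *\<^sub>R \<omega>)"
    have "energy ?p powr (1 / 2) / rel_momentum (four ?p) (four b) \<le> ?C * (1 / norm (\<omega> - c))"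
    proof (cases "\<omega> = c")
      \<comment> \<open>The right side is 0 here; so is the left, since the momentum equals b and
        the relative momentum vanishes.\<close>
      case True
      then show ?thesis using c(2)[OF \<omega>] rel_momentum_self by simp
    next
      case False
      then have d: "norm k * norm (\<omega> - c) > 0" using k by simp
      have e: "energy ?p \<le> total_energy P k"
        using energy_boost_less[of P "norm k *\<^sub>R \<omega>"] energy_scaleR_norm(2)[OF \<omega>, of P k] by simp
      have "energy ?p * sqrt (energy b) / norm (?p - b) \<le> total_energy P k * sqrt (energy b) / (norm k * norm (\<omega> - c))"
        using e d c(1)[OF \<omega>] by (intro frac_le mult_right_mono) (simp_all add: less_imp_le)
      also have "\<dots> = ?C * (1 / norm (\<omega> - c))" by simp
      finally show ?thesis using sqrt_energy_over_rel_momentum_le[of ?p b] by linarith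
    qed
    then show "ennreal (energy ?p powr (1 / 2) / rel_momentum (four ?p) (four b)) \<le> ennreal ?C * ?w \<omega>"
      using C by (subst ennreal_mult[symmetric]) (simp_all only: ennreal_leI zero_le_divide_1_iff norm_ge_zero)
  qed
  also have "\<dots> = ennreal ?C * (\<integral>\<^sup>+\<omega>. ?w \<omega> \<partial>sphere_measure)"
    by (intro nn_integral_cmult measurable_sphere_measure_borel) measurable
  also have "\<dots> \<le> ennreal ?C * ennreal (36 * pi)"
    by (intro mult_left_mono nn_integral_sphere_inverse_dist) simp
  finally have "ennreal ((norm k)\<^sup>2) * (\<integral>\<^sup>+\<omega>. ennreal (energy (boost P (norm k *\<^sub>R \<omega>)) powr (1 / 2) /
      rel_momentum (four (boost P (norm k *\<^sub>R \<omega>))) (four b)) \<partial>sphere_measure) \<le>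
    ennreal ((norm k)\<^sup>2) * (ennreal ?C * ennreal (36 * pi))"
    by (intro mult_left_mono) simp_all
  also have "\<dots> = ennreal (36 * pi * total_energy P k * sqrt (energy b) * norm k)"
    using C k by (simp add: ennreal_mult[symmetric] less_imp_le power2_eq_square)
  finally show ?thesis .
qed simp

section \<open>The estimate for Borel functions\<close>

lemma borel_measurable_collision [measurable]:
  fixes f g h :: "'b \<Rightarrow> vec3"
  assumes [measurable]: "f \<in> borel_measurable M" "g \<in> borel_measurable M" "h \<in> borel_measurable M"
  shows "(\<lambda>x. rel_momentum (four (f x)) (four (g x))) \<in> borel_measurable M"
    and "(\<lambda>x. moller (f x) (g x)) \<in> borel_measurable M"
    and "(\<lambda>x. post_p (f x) (g x) (h x)) \<in> borel_measurable M"
    and "(\<lambda>x. post_q (f x) (g x) (h x)) \<in> borel_measurable M"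
  unfolding moller_def post_p_def post_q_def collision_shift_def Let_def s_inv_four
    rel_momentum_def lorentz_four_diff_self
  by measurable

text \<open>Translate q to P = p + q, exchange the order of integration, and substitute p =
  \<open>boost P k\<close> for each fixed P.\<close>

lemma nn_integral_boost_pair:
  fixes H :: "vec3 \<Rightarrow> vec3 \<Rightarrow> ennreal"
  assumes [measurable]: "case_prod H \<in> borel_measurable (borel \<Otimes>\<^sub>M borel)"
  shows "(\<integral>\<^sup>+p. \<integral>\<^sup>+q. H p q \<partial>lborel \<partial>lborel) =
    (\<integral>\<^sup>+P. \<integral>\<^sup>+k. ennreal (boost_jacobian P k) * H (boost P k) (P - boost P k) \<partial>lborel \<partial>lborel)"
proof -
  have "(\<integral>\<^sup>+q. H p q \<partial>lborel) = (\<integral>\<^sup>+P. H p (P - p) \<partial>lborel)" for p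
  proof -
    have "(\<integral>\<^sup>+q. H p q \<partial>lborel) = (\<integral>\<^sup>+q. H p q \<partial>distr lborel borel (\<lambda>x. - p + x))"
      by (simp only: lborel_distr_plus)
    also have "\<dots> = (\<integral>\<^sup>+P. H p (P - p) \<partial>lborel)"
      by (subst nn_integral_distr) simp_all
    finally show ?thesis .
  qed
  then have "(\<integral>\<^sup>+p. \<integral>\<^sup>+q. H p q \<partial>lborel \<partial>lborel) = (\<integral>\<^sup>+p. \<integral>\<^sup>+P. H p (P - p) \<partial>lborel \<partial>lborel)"
    by simp
  also have "\<dots> = (\<integral>\<^sup>+P. \<integral>\<^sup>+p. H p (P - p) \<partial>lborel \<partial>lborel)"
    by (rule lborel_pair.Fubini') measurable
  also have "\<dots> = (\<integral>\<^sup>+P. \<integral>\<^sup>+k. ennreal (boost_jacobian P k) * H (boost P k) (P - boost P k) \<partial>lborel \<partial>lborel)"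
    by (intro nn_integral_cong nn_integral_boost) measurable
  finally show ?thesis .
qed

text \<open>Trades the remaining |k| for the Jacobian and the weight p0 q0 of the squared norm. It
  rests on |k| \<le> k0, k0^2 \<le> p0 q0 and S \<le> 2 p0 q0.\<close>

lemma norm_le_boost_jacobian:
  "norm k \<le> boost_jacobian P k * energy (boost P k) * energy (P - boost P k)"
proof -
  let ?p = "energy (boost P k)" and ?q = "energy (P - boost P k)"
  have "4 * (energy k)\<^sup>2 = 2 * (?p * ?q - boost P k \<bullet> (P - boost P k) + 1)"
    using s_inv_boost[of P k] by (simp add: s_inv_def lorentz_four)
  then have E: "(energy k)\<^sup>2 \<le> ?p * ?q"
    using abs_inner_add_one_le_energy[of "boost P k" "P - boost P k"]
      abs_ge_minus_self[of "boost P k \<bullet> (P - boost P k)"] by argo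
  \<comment> \<open>Hence p0 + q0 \<le> p0 q0 + 1 \<le> 2 p0 q0.\<close>
  have "(?p - 1) * (?q - 1) \<ge> 0" by (simp add: energy_ge_one)
  moreover have "?p * ?q \<ge> 1" using mult_mono[OF energy_ge_one energy_ge_one, of "boost P k" "P - boost P k"]
    by (simp add: less_imp_le)
  ultimately have S: "total_energy P k \<le> 2 * (?p * ?q)"
    unfolding energy_boost_add[of P k, symmetric] by (simp add: algebra_simps)
  have "norm k \<le> energy k" by (simp add: energy_def real_le_rsqrt)
  then have "norm k * (energy k * total_energy P k) \<le> energy k * (energy k * total_energy P k)"
    by (intro mult_right_mono) (simp_all add: less_imp_le)
  also have "\<dots> = (energy k)\<^sup>2 * total_energy P k" by (simp add: power2_eq_square)
  also have "\<dots> \<le> (?p * ?q) * (2 * (?p * ?q))"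
    using E S by (intro mult_mono) (simp_all add: less_imp_le)
  finally have "norm k * (energy k * total_energy P k) \<le> 2 * ?p * ?q * ?p * ?q" by (simp add: mult_ac)
  then have "norm k \<le> (2 * ?p * ?q * ?p * ?q) / (energy k * total_energy P k)"
    by (subst pos_le_divide_eq) simp_all
  then show ?thesis by (simp add: boost_jacobian_def)
qed

lemma weighted_gain_eq:
  fixes F G :: "vec3 \<Rightarrow> ennreal"
  assumes [measurable]: "F \<in> borel_measurable borel" "G \<in> borel_measurable borel"
  shows "(\<integral>\<^sup>+p. G p * (\<integral>\<^sup>+q. \<integral>\<^sup>+\<omega>. ennreal (moller p q * rel_momentum (four p) (four q)) *
      (F (post_p p q \<omega>) * F (post_q p q \<omega>)) \<partial>sphere_measure \<partial>lborel) \<partial>lborel) =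
    (\<integral>\<^sup>+P. \<integral>\<^sup>+k. \<integral>\<^sup>+\<omega>. ennreal (16 * (norm k)\<^sup>2 / total_energy P k) * G (boost P k) *
      (F (boost P (norm k *\<^sub>R \<omega>)) * F (P - boost P (norm k *\<^sub>R \<omega>))) \<partial>sphere_measure \<partial>lborel \<partial>lborel)"
proof -
  define K where "K p q = (\<integral>\<^sup>+\<omega>. ennreal (moller p q * rel_momentum (four p) (four q)) *
      (F (post_p p q \<omega>) * F (post_q p q \<omega>)) \<partial>sphere_measure)" for p q
  have K: "(\<lambda>z. K (fst z) (snd z)) \<in> borel_measurable (borel \<Otimes>\<^sub>M borel)"
    unfolding K_def by (rule borel_measurable_nn_integral_sphere) measurable
  then have [measurable]: "case_prod K \<in> borel_measurable (borel \<Otimes>\<^sub>M borel)" by (simp add: case_prod_beta')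
  have "(\<integral>\<^sup>+p. G p * (\<integral>\<^sup>+q. K p q \<partial>lborel) \<partial>lborel) = (\<integral>\<^sup>+p. \<integral>\<^sup>+q. G p * K p q \<partial>lborel \<partial>lborel)"
    by (intro nn_integral_cong nn_integral_cmult[symmetric]) measurable
  also have "\<dots> = (\<integral>\<^sup>+P. \<integral>\<^sup>+k. ennreal (boost_jacobian P k) * (G (boost P k) * K (boost P k) (P - boost P k)) \<partial>lborel \<partial>lborel)"
    by (rule nn_integral_boost_pair) measurable
  also have "\<dots> = (\<integral>\<^sup>+P. \<integral>\<^sup>+k. \<integral>\<^sup>+\<omega>. ennreal (16 * (norm k)\<^sup>2 / total_energy P k) * G (boost P k) *
      (F (boost P (norm k *\<^sub>R \<omega>)) * F (P - boost P (norm k *\<^sub>R \<omega>))) \<partial>sphere_measure \<partial>lborel \<partial>lborel)"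
  proof (intro nn_integral_cong)
    fix P k :: vec3
    define W where "W = ennreal (moller (boost P k) (P - boost P k) * (2 * norm k))"
    define I where "I = (\<integral>\<^sup>+\<omega>. F (boost P (norm k *\<^sub>R \<omega>)) * F (P - boost P (norm k *\<^sub>R \<omega>)) \<partial>sphere_measure)"
    have m: "(\<lambda>\<omega>. F (boost P (norm k *\<^sub>R \<omega>)) * F (P - boost P (norm k *\<^sub>R \<omega>))) \<in> borel_measurable sphere_measure"
      by (rule measurable_sphere_measure_borel) measurable
    have "K (boost P k) (P - boost P k) =
        (\<integral>\<^sup>+\<omega>. W * (F (boost P (norm k *\<^sub>R \<omega>)) * F (P - boost P (norm k *\<^sub>R \<omega>))) \<partial>sphere_measure)"
      unfolding K_def rel_momentum_boost W_def
      by (intro nn_integral_cong) (simp add: space_sphere_measure post_boost)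
    also have "\<dots> = W * I" unfolding I_def by (rule nn_integral_cmult[OF m])
    finally have "ennreal (boost_jacobian P k) * (G (boost P k) * K (boost P k) (P - boost P k)) =
        ennreal (boost_jacobian P k) * W * G (boost P k) * I" by (simp add: mult_ac)
    \<comment> \<open>The factors are 2 p0 q0 / (k0 S), 4 |k| k0 / (p0 q0) and 2 |k|; both energies
      and k0 cancel.\<close>
    also have "ennreal (boost_jacobian P k) * W = ennreal (16 * (norm k)\<^sup>2 / total_energy P k)"
      unfolding W_def moller_boost boost_jacobian_def
      by (subst ennreal_mult[symmetric]) (simp_all add: less_imp_le power2_eq_square divide_simps)
    also have "ennreal (16 * (norm k)\<^sup>2 / total_energy P k) * G (boost P k) * I =
       (\<integral>\<^sup>+\<omega>. ennreal (16 * (norm k)\<^sup>2 / total_energy P k) * G (boost P k) *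
      (F (boost P (norm k *\<^sub>R \<omega>)) * F (P - boost P (norm k *\<^sub>R \<omega>))) \<partial>sphere_measure)"
      unfolding I_def by (rule nn_integral_cmult[OF m, symmetric])
    finally show "ennreal (boost_jacobian P k) * (G (boost P k) * K (boost P k) (P - boost P k)) =
       (\<integral>\<^sup>+\<omega>. ennreal (16 * (norm k)\<^sup>2 / total_energy P k) * G (boost P k) *
      (F (boost P (norm k *\<^sub>R \<omega>)) * F (P - boost P (norm k *\<^sub>R \<omega>))) \<partial>sphere_measure)" .
  qed
  finally show ?thesis unfolding K_def .
qed

lemma weighted_gain_le:
  fixes F :: "vec3 \<Rightarrow> ennreal" and b :: vec3
  assumes F [measurable]: "F \<in> borel_measurable borel"
  shows "(\<integral>\<^sup>+p. ennreal (energy p powr (1 / 2) / rel_momentum (four p) (four b)) *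
      (\<integral>\<^sup>+q. \<integral>\<^sup>+\<omega>. ennreal (moller p q * rel_momentum (four p) (four q)) *
      (F (post_p p q \<omega>) * F (post_q p q \<omega>)) \<partial>sphere_measure \<partial>lborel) \<partial>lborel) \<le>
    ennreal (576 * pi * sqrt (energy b)) * (\<integral>\<^sup>+p. ennreal (energy p) * F p \<partial>lborel)\<^sup>2"
proof -
  define G where "G p = ennreal (energy p powr (1 / 2) / rel_momentum (four p) (four b))" for p
  have [measurable]: "G \<in> borel_measurable borel" unfolding G_def by measurable
  let ?N = "\<integral>\<^sup>+p. ennreal (energy p) * F p \<partial>lborel"
  let ?c = "ennreal (576 * pi * sqrt (energy b))"
  have "(\<integral>\<^sup>+p. G p * (\<integral>\<^sup>+q. \<integral>\<^sup>+\<omega>. ennreal (moller p q * rel_momentum (four p) (four q)) *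
      (F (post_p p q \<omega>) * F (post_q p q \<omega>)) \<partial>sphere_measure \<partial>lborel) \<partial>lborel) =
    (\<integral>\<^sup>+P. \<integral>\<^sup>+k. \<integral>\<^sup>+\<omega>. ennreal (16 * (norm k)\<^sup>2 / total_energy P k) * G (boost P k) *
      (F (boost P (norm k *\<^sub>R \<omega>)) * F (P - boost P (norm k *\<^sub>R \<omega>))) \<partial>sphere_measure \<partial>lborel \<partial>lborel)"
    by (rule weighted_gain_eq) measurable
  \<comment> \<open>After the exchange the weight depends on \<omega> while the two values of F do
    not, so F leaves the integral over the sphere.\<close>
  also have "\<dots> = (\<integral>\<^sup>+P. \<integral>\<^sup>+k. \<integral>\<^sup>+\<omega>. ennreal (16 * (norm (norm k *\<^sub>R \<omega>))\<^sup>2 / total_energy P (norm k *\<^sub>R \<omega>)) *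
      G (boost P (norm k *\<^sub>R \<omega>)) * (F (boost P k) * F (P - boost P k)) \<partial>sphere_measure \<partial>lborel \<partial>lborel)"
    by (intro nn_integral_cong nn_integral_sphere_swap[where
        B = "\<lambda>k l. ennreal (16 * (norm k)\<^sup>2 / total_energy _ k) * G (boost _ k) * (F (boost _ l) * F (_ - boost _ l))"])
      measurable
  also have "\<dots> \<le> (\<integral>\<^sup>+P. \<integral>\<^sup>+k. ?c * (ennreal (boost_jacobian P k) *
      (ennreal (energy (boost P k)) * F (boost P k) * (ennreal (energy (P - boost P k)) * F (P - boost P k)))) \<partial>lborel \<partial>lborel)"
  proof (intro nn_integral_mono)
    fix P k :: vec3
    define FF where "FF = F (boost P k) * F (P - boost P k)"
    define S where "S = total_energy P k"
    have S: "S > 0" by (simp add: S_def)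
    let ?I = "\<integral>\<^sup>+\<omega>. G (boost P (norm k *\<^sub>R \<omega>)) \<partial>sphere_measure"
    have "(\<integral>\<^sup>+\<omega>. ennreal (16 * (norm (norm k *\<^sub>R \<omega>))\<^sup>2 / total_energy P (norm k *\<^sub>R \<omega>)) *
        G (boost P (norm k *\<^sub>R \<omega>)) * FF \<partial>sphere_measure) =
      (\<integral>\<^sup>+\<omega>. (ennreal (16 / S) * FF * ennreal ((norm k)\<^sup>2)) * G (boost P (norm k *\<^sub>R \<omega>)) \<partial>sphere_measure)"
    proof (rule nn_integral_cong)
      fix \<omega> :: vec3 assume "\<omega> \<in> space sphere_measure"
      then have \<omega>: "norm \<omega> = 1" by (simp add: space_sphere_measure)
      have "ennreal (16 * (norm (norm k *\<^sub>R \<omega>))\<^sup>2 / total_energy P (norm k *\<^sub>R \<omega>)) = ennreal (16 / S * (norm k)\<^sup>2)"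
        using \<omega> by (simp add: energy_scaleR_norm S_def)
      also have "\<dots> = ennreal (16 / S) * ennreal ((norm k)\<^sup>2)" using S by (intro ennreal_mult) simp_all
      finally show "ennreal (16 * (norm (norm k *\<^sub>R \<omega>))\<^sup>2 / total_energy P (norm k *\<^sub>R \<omega>)) *
        G (boost P (norm k *\<^sub>R \<omega>)) * FF = (ennreal (16 / S) * FF * ennreal ((norm k)\<^sup>2)) * G (boost P (norm k *\<^sub>R \<omega>))"
        by (simp add: mult_ac)
    qed
    also have "\<dots> = ennreal (16 / S) * FF * ennreal ((norm k)\<^sup>2) * ?I"
      by (intro nn_integral_cmult measurable_sphere_measure_borel) measurable
    also have "\<dots> = ennreal (16 / S) * FF * (ennreal ((norm k)\<^sup>2) * ?I)" by (simp add: mult_ac)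
    also have "\<dots> \<le> ennreal (16 / S) * FF * ennreal (36 * pi * S * sqrt (energy b) * norm k)"
      unfolding G_def S_def by (intro mult_left_mono nn_integral_sphere_weight_le) simp
    also have "\<dots> = ennreal (16 / S * (36 * pi * S * sqrt (energy b) * norm k)) * FF"
      using S by (subst ennreal_mult) (simp_all add: less_imp_le mult_ac)
    \<comment> \<open>The total energy from the averaged weight cancels the one in the denominator,
      and 576 = 16 * 36.\<close>
    also have "16 / S * (36 * pi * S * sqrt (energy b) * norm k) = 576 * pi * sqrt (energy b) * norm k"
      using S by simp
    also have "ennreal (576 * pi * sqrt (energy b) * norm k) = ?c * ennreal (norm k)"
      by (intro ennreal_mult) (simp_all add: less_imp_le)
    also have "?c * ennreal (norm k) * FF \<le>
       ?c * ennreal (boost_jacobian P k * energy (boost P k) * energy (P - boost P k)) * FF"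
      by (intro mult_right_mono mult_left_mono ennreal_leI norm_le_boost_jacobian) simp_all
    also have "\<dots> = ?c * (ennreal (boost_jacobian P k) *
      (ennreal (energy (boost P k)) * F (boost P k) * (ennreal (energy (P - boost P k)) * F (P - boost P k))))"
      unfolding FF_def using boost_jacobian_pos[of P k] by (simp add: ennreal_mult less_imp_le mult_ac)
    finally show "(\<integral>\<^sup>+\<omega>. ennreal (16 * (norm (norm k *\<^sub>R \<omega>))\<^sup>2 / total_energy P (norm k *\<^sub>R \<omega>)) *
        G (boost P (norm k *\<^sub>R \<omega>)) * (F (boost P k) * F (P - boost P k)) \<partial>sphere_measure) \<le>
      ?c * (ennreal (boost_jacobian P k) *
      (ennreal (energy (boost P k)) * F (boost P k) * (ennreal (energy (P - boost P k)) * F (P - boost P k))))"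
      unfolding FF_def .
  qed
  also have "\<dots> = ?c * (\<integral>\<^sup>+P. \<integral>\<^sup>+k. ennreal (boost_jacobian P k) *
      (ennreal (energy (boost P k)) * F (boost P k) * (ennreal (energy (P - boost P k)) * F (P - boost P k))) \<partial>lborel \<partial>lborel)"
    by (subst nn_integral_cmult[symmetric], measurable, intro nn_integral_cong nn_integral_cmult) measurable
  also have "(\<integral>\<^sup>+P. \<integral>\<^sup>+k. ennreal (boost_jacobian P k) *
      (ennreal (energy (boost P k)) * F (boost P k) * (ennreal (energy (P - boost P k)) * F (P - boost P k))) \<partial>lborel \<partial>lborel) =
    (\<integral>\<^sup>+p. \<integral>\<^sup>+q. ennreal (energy p) * F p * (ennreal (energy q) * F q) \<partial>lborel \<partial>lborel)"
    by (rule nn_integral_boost_pair[symmetric]) measurable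
  also have "\<dots> = ?N\<^sup>2"
    by (simp add: nn_integral_cmult nn_integral_multc power2_eq_square)
  finally show ?thesis unfolding G_def .
qed

section \<open>Reduction to the Borel estimate\<close>

text \<open>A Lebesgue measurable f agrees almost everywhere with a Borel function; setting the
  latter to infinity on a Borel null set containing all disagreements gives a bound at every point.
  The bound thus survives composition with the collision maps, and the weighted integral is
  unchanged.\<close>

lemma L11_majorant:
  assumes "L11 f" and nonneg: "\<And>p. f p \<ge> 0"
  obtains F :: "vec3 \<Rightarrow> ennreal" where "F \<in> borel_measurable borel" "\<And>p. ennreal (f p) \<le> F p"
    "(\<integral>\<^sup>+p. ennreal (energy p) * F p \<partial>lborel) = ennreal (L11_norm f)"
proof -
  have f: "f \<in> borel_measurable (completion lborel)" and int: "integrable lebesgue (\<lambda>p. energy p * \<bar>f p\<bar>)"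
    using assms by (simp_all add: L11_def)
  have "(\<lambda>p. ennreal (f p)) \<in> borel_measurable (completion lborel)" using f by measurable
  then obtain h where [measurable]: "h \<in> borel_measurable lborel" and h: "AE p in lborel. ennreal (f p) = h p"
    using completion_ex_borel_measurable by blast
  from h obtain N where N: "N \<in> null_sets lborel" "{p \<in> space lborel. ennreal (f p) \<noteq> h p} \<subseteq> N"
    by (auto simp: eventually_ae_filter)
  then have [measurable]: "N \<in> sets borel" by auto
  define F where "F p = (if p \<in> N then top else h p)" for p
  have [measurable]: "F \<in> borel_measurable borel" unfolding F_def by measurable
  have "(\<integral>\<^sup>+p. ennreal (energy p) * F p \<partial>lborel) = (\<integral>\<^sup>+p. ennreal (energy p * \<bar>f p\<bar>) \<partial>lborel)"
  proof (rule nn_integral_cong_AE)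
    show "AE p in lborel. ennreal (energy p) * F p = ennreal (energy p * \<bar>f p\<bar>)"
      using h AE_not_in[OF N(1)]
    proof eventually_elim
      case (elim p)
      then show ?case using nonneg[of p] by (simp add: F_def ennreal_mult less_imp_le elim(1)[symmetric])
    qed
  qed
  also have "\<dots> = (\<integral>\<^sup>+p. ennreal (energy p * \<bar>f p\<bar>) \<partial>lebesgue)" by (simp add: nn_integral_completion)
  also have "\<dots> = ennreal (L11_norm f)"
    unfolding L11_norm_def by (rule nn_integral_eq_integral[OF int]) (simp add: less_imp_le)
  finally have "(\<integral>\<^sup>+p. ennreal (energy p) * F p \<partial>lborel) = ennreal (L11_norm f)" .
  moreover have "ennreal (f p) \<le> F p" for p
  proof (cases "p \<in> N")
    case False
    then have "ennreal (f p) = h p" using N(2) by auto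
    with False show ?thesis by (simp add: F_def)
  qed (simp add: F_def)
  ultimately show thesis by (intro that[of F]) simp_all
qed

lemma gain_le:
  assumes c: "\<And>g \<theta>. g > 0 \<Longrightarrow> \<theta> \<in> {0..pi} \<Longrightarrow> \<sigma> g \<theta> \<le> c * g" and "c > 0"
    and f: "\<And>p. f p \<ge> 0" "\<And>p. ennreal (f p) \<le> F p" and [measurable]: "F \<in> borel_measurable borel"
  shows "gain \<sigma> f f p \<le> ennreal c * (\<integral>\<^sup>+q. \<integral>\<^sup>+\<omega>. ennreal (moller p q * rel_momentum (four p) (four q)) *
      (F (post_p p q \<omega>) * F (post_q p q \<omega>)) \<partial>sphere_measure \<partial>lborel)"
proof -
  let ?B = "\<lambda>(q, \<omega>). ennreal (moller p q * rel_momentum (four p) (four q)) * (F (post_p p q \<omega>) * F (post_q p q \<omega>))"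
  have m: "?B \<in> borel_measurable (lborel \<Otimes>\<^sub>M sphere_measure)"
    by (rule measurable_pair_sphere_measure) measurable
  have "gain \<sigma> f f p \<le> (\<integral>\<^sup>+z. ennreal c * ?B z \<partial>(lborel \<Otimes>\<^sub>M sphere_measure))"
    unfolding gain_def
  proof (rule nn_integral_mono, clarsimp simp: space_pair_measure space_sphere_measure)
    fix q \<omega> :: vec3 assume \<omega>: "norm \<omega> = 1"
    let ?g = "rel_momentum (four p) (four q)" and ?\<sigma> = "\<sigma> (rel_momentum (four p) (four q)) (scattering_angle p q \<omega>)"
    have m0: "moller p q \<ge> 0"
      using rel_momentum_four_nonneg[of p q] by (simp add: moller_def s_inv_four less_imp_le)
    have "moller p q * ?\<sigma> \<le> c * (moller p q * ?g)"
    proof (cases "?g = 0")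
      \<comment> \<open>The kernel bound is assumed only for g > 0; at g = 0 the Moller velocity
        vanishes.\<close>
      case True
      then show ?thesis by (simp add: moller_def)
    next
      case False
      then have "?\<sigma> \<le> c * ?g"
        using rel_momentum_four_nonneg[of p q] scattering_angle_range[OF \<omega>] by (intro c) auto
      then have "moller p q * ?\<sigma> \<le> moller p q * (c * ?g)" using m0 by (rule mult_left_mono)
      then show ?thesis by (simp add: mult_ac)
    qed
    then have "moller p q * ?\<sigma> * f (post_p p q \<omega>) * f (post_q p q \<omega>) \<le>
        c * (moller p q * ?g) * (f (post_p p q \<omega>) * f (post_q p q \<omega>))"
      unfolding mult.assoc[of _ "f (post_p p q \<omega>)"] using f by (intro mult_right_mono) simp_all
    then have "ennreal (moller p q * ?\<sigma> * f (post_p p q \<omega>) * f (post_q p q \<omega>)) \<le>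
        ennreal (c * (moller p q * ?g) * (f (post_p p q \<omega>) * f (post_q p q \<omega>)))" by (rule ennreal_leI)
    also have "\<dots> = ennreal c * (ennreal (moller p q * ?g) * (ennreal (f (post_p p q \<omega>)) * ennreal (f (post_q p q \<omega>))))"
      using \<open>c > 0\<close> f m0 rel_momentum_four_nonneg[of p q] by (simp add: ennreal_mult mult_ac)
    also have "\<dots> \<le> ennreal c * (ennreal (moller p q * ?g) * (F (post_p p q \<omega>) * F (post_q p q \<omega>)))"
      by (intro mult_left_mono mult_mono f) simp_all
    finally show "ennreal (moller p q * ?\<sigma> * f (post_p p q \<omega>) * f (post_q p q \<omega>)) \<le>
        ennreal c * (ennreal (moller p q * ?g) * (F (post_p p q \<omega>) * F (post_q p q \<omega>)))" .
  qed
  also have "\<dots> = ennreal c * (\<integral>\<^sup>+z. ?B z \<partial>(lborel \<Otimes>\<^sub>M sphere_measure))"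
    by (rule nn_integral_cmult[OF m])
  also have "(\<integral>\<^sup>+z. ?B z \<partial>(lborel \<Otimes>\<^sub>M sphere_measure)) =
      (\<integral>\<^sup>+q. \<integral>\<^sup>+\<omega>. ?B (q, \<omega>) \<partial>sphere_measure \<partial>lborel)"
    by (rule sigma_finite_measure.nn_integral_fst[OF sigma_finite_sphere_measure m, symmetric])
  finally show ?thesis by simp
qed

theorem proposition3p2:
  fixes \<sigma> :: "real \<Rightarrow> real \<Rightarrow> real"
  assumes "collision_kernel \<sigma>"
    and "kernel_approx_g \<sigma>"
  shows "\<exists>C>0. \<forall>(f :: vec3 \<Rightarrow> real) (a :: vec4).
           (\<forall>p. f p \<ge> 0) \<longrightarrow> L11 f \<longrightarrow> energy_momentum a \<longrightarrow>
           (\<integral>\<^sup>+p. ennreal (energy p powr (1 / 2) / rel_momentum (four p) a) * gain \<sigma> f f p \<partial>lborel)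
             \<le> ennreal (C * sqrt (fst a) * (L11_norm f)\<^sup>2)"
proof -
  from assms(2) obtain c where "c > 0" and c: "\<And>g \<theta>. g > 0 \<Longrightarrow> \<theta> \<in> {0..pi} \<Longrightarrow> \<sigma> g \<theta> \<le> c * g"
    unfolding kernel_approx_g_def by blast
  show ?thesis
  \<comment> \<open>The factor c comes from the upper kernel bound, 576 \<pi> from
    \<open>weighted_gain_le\<close>.\<close>
  proof (intro exI[of _ "c * (576 * pi)"] conjI allI impI)
    show "c * (576 * pi) > 0" using \<open>c > 0\<close> by simp
  next
    fix f :: "vec3 \<Rightarrow> real" and a :: vec4
    assume f: "\<forall>p. f p \<ge> 0" "L11 f" and "energy_momentum a"
    \<comment> \<open>The mass-shell condition with positive time component makes a the four-vector
      of its spatial part.\<close>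
    then have "(fst a)\<^sup>2 = 1 + (norm (snd a))\<^sup>2" "fst a > 0"
      by (simp_all add: energy_momentum_def lorentz_def power2_eq_square[of "fst a"] power2_norm_eq_inner)
    then have a0: "fst a = energy (snd a)" by (simp add: energy_def real_sqrt_unique less_imp_le)
    then have a: "a = four (snd a)" by (simp add: four_def prod_eq_iff)
    obtain F where [measurable]: "F \<in> borel_measurable borel" and F: "\<And>p. ennreal (f p) \<le> F p"
      and N: "(\<integral>\<^sup>+p. ennreal (energy p) * F p \<partial>lborel) = ennreal (L11_norm f)"
      using L11_majorant[of f] f by metis
    define b where "b = snd a"
    let ?K = "\<lambda>p. \<integral>\<^sup>+q. \<integral>\<^sup>+\<omega>. ennreal (moller p q * rel_momentum (four p) (four q)) *
      (F (post_p p q \<omega>) * F (post_q p q \<omega>)) \<partial>sphere_measure \<partial>lborel"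
    let ?G = "\<lambda>p. ennreal (energy p powr (1 / 2) / rel_momentum (four p) (four b))"
    have "(\<lambda>z. \<integral>\<^sup>+\<omega>. ennreal (moller (fst z) (snd z) * rel_momentum (four (fst z)) (four (snd z))) *
      (F (post_p (fst z) (snd z) \<omega>) * F (post_q (fst z) (snd z) \<omega>)) \<partial>sphere_measure)
      \<in> borel_measurable (borel \<Otimes>\<^sub>M lborel)"
      by (rule borel_measurable_nn_integral_sphere) measurable
    then have [measurable]: "?K \<in> borel_measurable borel"
      by (intro sigma_finite_measure.borel_measurable_nn_integral[OF sigma_finite_lborel]) (simp add: case_prod_beta')
    have N0: "L11_norm f \<ge> 0"
      unfolding L11_norm_def by (intro integral_nonneg_AE AE_I2) (simp add: less_imp_le)
    have "(\<integral>\<^sup>+p. ?G p * gain \<sigma> f f p \<partial>lborel) \<le> (\<integral>\<^sup>+p. ennreal c * (?G p * ?K p) \<partial>lborel)"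
    proof (rule nn_integral_mono)
      fix p
      have "?G p * gain \<sigma> f f p \<le> ?G p * (ennreal c * ?K p)"
        using f F \<open>c > 0\<close> c by (intro mult_left_mono gain_le) auto
      then show "?G p * gain \<sigma> f f p \<le> ennreal c * (?G p * ?K p)" by (simp add: mult_ac)
    qed
    also have "\<dots> = ennreal c * (\<integral>\<^sup>+p. ?G p * ?K p \<partial>lborel)"
      by (rule nn_integral_cmult) measurable
    also have "\<dots> \<le> ennreal c * (ennreal (576 * pi * sqrt (energy b)) * (ennreal (L11_norm f))\<^sup>2)"
      using weighted_gain_le[of F b] by (intro mult_left_mono) (simp_all add: N)
    also have "\<dots> = ennreal (c * (576 * pi * sqrt (energy b) * (L11_norm f)\<^sup>2))"
      using \<open>c > 0\<close> N0 by (simp add: ennreal_mult ennreal_power less_imp_le)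
    finally show "(\<integral>\<^sup>+p. ennreal (energy p powr (1 / 2) / rel_momentum (four p) a) * gain \<sigma> f f p \<partial>lborel)
             \<le> ennreal (c * (576 * pi) * sqrt (fst a) * (L11_norm f)\<^sup>2)"
      unfolding b_def a0 a[symmetric] by (simp add: mult_ac)
  qed
qed

end
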